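(* Suppose that there exist $Q,\beta_p\in(0,\infty)$ with $\beta_p>Q$ such that the following hold: (i) $m(K)<\infty$ and $m$ is volume doubling with growth exponent $Q$. (ii) $(\mathrm{WM})_{p,\boldsymbol{k}}$ holds. (iii) $\{u\in B_{p,\infty}^{\boldsymbol{k}}:\sup_{r>0}J_{p,r}^{\boldsymbol{k}}(u)=0\}=\mathbb{R}\mathbf{1}_K$. (iv) $B_{p,\infty}^{\boldsymbol{k}}\subseteq C(K)$, and there exists $C\in(0,\infty)$ such that for any $f\in B_{p,\infty}^{\boldsymbol{k}}$ and any $x,y\in K$, $|f(x)-f(y)|\le C\,d(x,y)^{(\beta_p-Q)/p}\sup_{r>0}J_{p,r}^{\boldsymbol{k}}(f)^{1/p}$. (v) There exists $C\in(0,\infty)$ such that for any $(x,s)\in K\times(0,\infty)$ with $B_d(x,s)\neq K$, $$\inf\Bigl\{\sup_{r>0}J_{p,r}^{\boldsymbol{k}}(f)\Bigm| f\in C(K),\ \operatorname{supp}_K[f]\subseteq B_d(x,2s),\ f\ge1\text{ on }B_d(x,s)\Bigr\}\le C\,\frac{m(B_d(x,s))}{s^{\beta_p}}.$$ Then any $\boldsymbol{k}$-Korevaar--Schoen $p$-energy form $(\mathcal{E}_p^{\boldsymbol{k}},B_{p,\infty}^{\boldsymbol{k}})$ on $(K,m)$ is a $p$-resistance form on $K$. If in addition $m$ is $Q$-Ahlfors regular, then there exist $\alpha_0,\alpha_1\in(0,\infty)$ such that for any such $(\mathcal{E}_p^{\boldsymbol{k}},B_{p,\infty}^{\boldsymbol{k}})$,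 $$\alpha_0\,d(x,y)^{\beta_p-Q}\le R_{\mathcal{E}_p^{\boldsymbol{k}}}(x,y)\le\alpha_1\,d(x,y)^{\beta_p-Q}\quad\text{for any }x,y\in K.$$
   Context: Setting. $p\in(1,\infty)$; $(K,d)$ is a separable metric space with at least two points; $m$ is a $\sigma$-finite Borel measure on $K$ with full topological support; $B_d(x,r)=\{y: d(x,y)<r\}$; $C(K)$ is the space of continuous real functions on $K$, identified with a subset of the space $L^0(K,m)$ of $m$-equivalence classes of measurable functions; $\operatorname{supp}_K[f]$ is the closure of $\{f\ne0\}$; $\mathbf{1}_K$ is the constant function $1$. $\boldsymbol{k}=\{k_r\}_{r>0}$ is a family of $[0,\infty]$-valued Borel measurable functions on $K\times K$. For measurable $f$ and $r>0$, $J_{p,r}^{\boldsymbol{k}}(f)=\int_K\int_K|f(x)-f(y)|^pk_r(x,y)\,m(dy)\,m(dx)\in[0,\infty]$, and $B_{p,\infty}^{\boldsymbol{k}}=\{f\in L^p(K,m):\sup_{r>0}J_{p,r}^{\boldsymbol{k}}(f)<\infty\}$. $(\mathrm{WM})_{p,\boldsymbol{k}}$ holds if there is $C\in[1,\infty)$ with $\sup_{r>0}J_{p,r}^{\boldsymbol{k}}(f)\le C\liminf_{r\downarrow0}J_{p,r}^{\boldsymbol{k}}(f)$ for all $f\in B_{p,\infty}^{\boldsymbol{k}}$. Under $(\mathrm{WM})_{p,\boldsymbol{k}}$, any positive sequence tending to $0$ has a subsequence $\{r_n\}$ along which $\mathcal{E}_p^{\boldsymbol{k}}(f):=\lim_{n\to\infty}J_{p,r_n}^{\boldsymbol{k}}(f)$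 exists in $[0,\infty)$ for all $f\in B_{p,\infty}^{\boldsymbol{k}}$; for each such sequence $\{r_n\}$, $(\mathcal{E}_p^{\boldsymbol{k}},B_{p,\infty}^{\boldsymbol{k}})$ is called a $\boldsymbol{k}$-Korevaar--Schoen $p$-energy form on $(K,m)$. $m$ is volume doubling with growth exponent $Q$ if there is $C'\in(0,\infty)$ with $m(B_d(x,s))\le C'(s/r)^Qm(B_d(x,r))<\infty$ for all $x\in K$, $0<r\le s$. $m$ is $Q$-Ahlfors regular if there is $C\in[1,\infty)$ with $C^{-1}s^Q\le m(B_d(x,s))\le Cs^Q$ for all $x\in K$, $s\in(0,2\operatorname{diam}(K,d))$. A pair $(\mathcal{E},\mathcal{F})$ of $\mathcal{F}\subseteq\mathbb{R}^K$ and $\mathcal{E}\colon\mathcal{F}\to[0,\infty)$ is a $p$-resistance form on $K$ if: (RF1) $\mathcal{F}$ is a linear subspace of $\mathbb{R}^K$ containing $\mathbb{R}\mathbf{1}_K$, and $\mathcal{E}^{1/p}$ is a seminorm on $\mathcal{F}$ with $\{u:\mathcal{E}(u)=0\}=\mathbb{R}\mathbf{1}_K$; (RF2) $(\mathcal{F}/\mathbb{R}\mathbf{1}_K,\mathcal{E}^{1/p})$ is a Banach space; (RF3) for $x\ne y\in K$ there is $u\in\mathcal{F}$ with $u(x)\ne u(y)$; (RF4) $R_{\mathcal{E}}(x,y):=\sup\{|u(x)-u(y)|^p/\mathcal{E}(u):u\in\mathcal{F}\setminus\mathbb{R}\mathbf{1}_K\}<\infty$ for all $x,y\in K$; (RF5)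 $(\mathcal{E},\mathcal{F})$ satisfies $(\mathrm{GC})_p$: whenever $n_1,n_2\in\mathbb{N}$, $q_1\in(0,p]$, $q_2\in[p,\infty]$ and $T=(T_1,\dots,T_{n_2})\colon\mathbb{R}^{n_1}\to\mathbb{R}^{n_2}$ satisfies $T(0)=0$ and $\|T(x)-T(y)\|_{\ell^{q_2}}\le\|x-y\|_{\ell^{q_1}}$ for all $x,y$, then for all $\boldsymbol{u}=(u_1,\dots,u_{n_1})\in\mathcal{F}^{n_1}$ one has $T(\boldsymbol{u})\in\mathcal{F}^{n_2}$ and $\|(\mathcal{E}(T_l(\boldsymbol{u}))^{1/p})_{l}\|_{\ell^{q_2}}\le\|(\mathcal{E}(u_k)^{1/p})_{k}\|_{\ell^{q_1}}$, where $\|x\|_{\ell^q}=(\sum_k|x_k|^q)^{1/q}$ for $q<\infty$ and $\|x\|_{\ell^\infty}=\max_k|x_k|$. *)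

theory Defs
  imports "HOL-Analysis.Analysis"
begin

section \<open>Resistance forms\<close>

text \<open>A vector of \<open>\<real>\<^sup>n\<close> is a function \<open>nat \<Rightarrow> real\<close> of which only the values at indices below \<open>n\<close>
  matter. The exponent is an extended real so that \<open>q = \<infinity>\<close> is allowed.\<close>

definition lq_norm :: "ereal \<Rightarrow> nat \<Rightarrow> (nat \<Rightarrow> real) \<Rightarrow> real" where
  "lq_norm q n x =
     (if q = \<infinity> then Max ((\<lambda>i. \<bar>x i\<bar>) ` {..<n})
      else (\<Sum>i<n. \<bar>x i\<bar> powr real_of_ereal q) powr (1 / real_of_ereal q))"

text \<open>A map \<open>T\<close> from n1-dimensional to n2-dimensional space is a function on \<open>nat \<Rightarrow> real\<close>.
  The Lipschitz condition already forces \<open>T x l\<close>, for \<open>l < n2\<close>, to depend only on the coordinates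
  of \<open>x\<close> below \<open>n1\<close>: if \<open>x\<close> and \<open>y\<close> agree there, its right-hand side vanishes.\<close>

definition generalized_contraction ::
  "real \<Rightarrow> (('a \<Rightarrow> real) \<Rightarrow> real) \<Rightarrow> ('a \<Rightarrow> real) set \<Rightarrow> bool" where
  "generalized_contraction p E F \<longleftrightarrow>
     (\<forall>(n1::nat) (n2::nat) (q1::ereal) (q2::ereal) (T :: (nat \<Rightarrow> real) \<Rightarrow> nat \<Rightarrow> real).
        1 \<le> n1 \<and> 1 \<le> n2 \<and> 0 < q1 \<and> q1 \<le> ereal p \<and> ereal p \<le> q2 \<and>
        (\<forall>l<n2. T (\<lambda>_. 0) l = 0) \<and>
        (\<forall>x y. lq_norm q2 n2 (\<lambda>l. T x l - T y l) \<le> lq_norm q1 n1 (\<lambda>i. x i - y i)) \<longrightarrow>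
        (\<forall>u :: nat \<Rightarrow> 'a \<Rightarrow> real. (\<forall>i<n1. u i \<in> F) \<longrightarrow>
           (\<forall>l<n2. (\<lambda>x. T (\<lambda>i. u i x) l) \<in> F) \<and>
           lq_norm q2 n2 (\<lambda>l. E (\<lambda>x. T (\<lambda>i. u i x) l) powr (1 / p))
             \<le> lq_norm q1 n1 (\<lambda>i. E (u i) powr (1 / p))))"

abbreviation constants :: "('a \<Rightarrow> real) set" where
  "constants \<equiv> range (\<lambda>c _. c)"

definition mod_constants :: "('a \<Rightarrow> real) set \<Rightarrow> ('a \<Rightarrow> real) set set" where
  "mod_constants F = F // {(u, v). u \<in> F \<and> v \<in> F \<and> (\<lambda>x. u x - v x) \<in> constants}"

text \<open>The distance induced on the quotient by the seminorm \<open>E\<^sup>1\<^sup>/\<^sup>p\<close>. The choice of representatives is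
  immaterial when that seminorm vanishes on constants. The value \<open>0\<close> off the quotient is only there
  because \<^locale>\<open>Metric_space\<close> asks for symmetry and nonnegativity outside the carrier, too.\<close>

definition quotient_dist ::
  "real \<Rightarrow> (('a \<Rightarrow> real) \<Rightarrow> real) \<Rightarrow> ('a \<Rightarrow> real) set \<Rightarrow> ('a \<Rightarrow> real) set \<Rightarrow> ('a \<Rightarrow> real) set \<Rightarrow> real"
  where
  "quotient_dist p E F U V =
     (if U \<in> mod_constants F \<and> V \<in> mod_constants F
      then E (\<lambda>x. (SOME u. u \<in> U) x - (SOME v. v \<in> V) x) powr (1 / p) else 0)"

definition resistance ::
  "real \<Rightarrow> (('a \<Rightarrow> real) \<Rightarrow> real) \<Rightarrow> ('a \<Rightarrow> real) set \<Rightarrow> 'a \<Rightarrow> 'a \<Rightarrow> ennreal" where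
  "resistance p E F x y = (SUP u \<in> F - constants. ennreal (\<bar>u x - u y\<bar> powr p / E u))"

text \<open>The carrier is the whole type \<open>'a\<close>; only the values of \<open>E\<close> on \<open>F\<close> matter.\<close>

definition resistance_form ::
  "real \<Rightarrow> (('a \<Rightarrow> real) \<Rightarrow> real) \<Rightarrow> ('a \<Rightarrow> real) set \<Rightarrow> bool" where
  "resistance_form p E F \<longleftrightarrow>
     (\<forall>u\<in>F. 0 \<le> E u) \<and>
     constants \<subseteq> F \<and>
     (\<forall>u\<in>F. \<forall>v\<in>F. (\<lambda>x. u x + v x) \<in> F) \<and>
     (\<forall>u\<in>F. \<forall>a. (\<lambda>x. a * u x) \<in> F) \<and>
     (\<forall>u\<in>F. \<forall>a. E (\<lambda>x. a * u x) powr (1 / p) = \<bar>a\<bar> * E u powr (1 / p)) \<and>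
     (\<forall>u\<in>F. \<forall>v\<in>F. E (\<lambda>x. u x + v x) powr (1 / p) \<le> E u powr (1 / p) + E v powr (1 / p)) \<and>
     {u \<in> F. E u = 0} = constants \<and>
     Metric_space (mod_constants F) (quotient_dist p E F) \<and>
     Metric_space.mcomplete (mod_constants F) (quotient_dist p E F) \<and>
     (\<forall>x y. x \<noteq> y \<longrightarrow> (\<exists>u\<in>F. u x \<noteq> u y)) \<and>
     (\<forall>x y. resistance p E F x y < \<infinity>) \<and>
     generalized_contraction p E F"

section \<open>Korevaar--Schoen energies\<close>

text \<open>Elements of \<open>L\<^sup>0(K,m)\<close> are represented by measurable functions; \<open>KS_J\<close> is invariant
  under equality \<open>m\<close>-almost everywhere.\<close>

definition KS_J ::
  "'a measure \<Rightarrow> (real \<Rightarrow> 'a \<times> 'a \<Rightarrow> ennreal) \<Rightarrow> real \<Rightarrow> real \<Rightarrow> ('a \<Rightarrow> real) \<Rightarrow> ennreal" where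
  "KS_J m k p r f =
     (\<integral>\<^sup>+ x. (\<integral>\<^sup>+ y. ennreal (\<bar>f x - f y\<bar> powr p) * k r (x, y) \<partial>m) \<partial>m)"

definition KS_sup ::
  "'a measure \<Rightarrow> (real \<Rightarrow> 'a \<times> 'a \<Rightarrow> ennreal) \<Rightarrow> real \<Rightarrow> ('a \<Rightarrow> real) \<Rightarrow> ennreal" where
  "KS_sup m k p f = (SUP r \<in> {0<..}. KS_J m k p r f)"

definition KS_space ::
  "'a measure \<Rightarrow> (real \<Rightarrow> 'a \<times> 'a \<Rightarrow> ennreal) \<Rightarrow> real \<Rightarrow> ('a \<Rightarrow> real) set" where
  "KS_space m k p =
     {f \<in> borel_measurable m. (\<integral>\<^sup>+ x. ennreal (\<bar>f x\<bar> powr p) \<partial>m) < \<infinity> \<and> KS_sup m k p f < \<infinity>}"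

text \<open>If \<open>m\<close> has full support, an almost-everywhere class has at most one continuous member. When every
  class in \<^const>\<open>KS_space\<close> has one, the following is that space viewed as a set of functions on \<open>K\<close>.\<close>

definition KS_cont_space ::
  "'a::topological_space measure \<Rightarrow> (real \<Rightarrow> 'a \<times> 'a \<Rightarrow> ennreal) \<Rightarrow> real \<Rightarrow> ('a \<Rightarrow> real) set" where
  "KS_cont_space m k p = {f \<in> KS_space m k p. continuous_on UNIV f}"

definition weak_monotonicity ::
  "'a measure \<Rightarrow> (real \<Rightarrow> 'a \<times> 'a \<Rightarrow> ennreal) \<Rightarrow> real \<Rightarrow> bool" where
  "weak_monotonicity m k p \<longleftrightarrow>
     (\<exists>C::real. 1 \<le> C \<and> (\<forall>f \<in> KS_space m k p.
        KS_sup m k p f \<le> ennreal C * Liminf (at_right 0) (\<lambda>r. KS_J m k p r f)))"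

text \<open>A Korevaar--Schoen energy form is \<open>KS_energy m k p r\<close> on \<open>KS_cont_space m k p\<close> for some
  \<open>r\<close> satisfying \<open>KS_sequence m k p r\<close>; different sequences may give different forms.\<close>

definition KS_sequence ::
  "'a measure \<Rightarrow> (real \<Rightarrow> 'a \<times> 'a \<Rightarrow> ennreal) \<Rightarrow> real \<Rightarrow> (nat \<Rightarrow> real) \<Rightarrow> bool" where
  "KS_sequence m k p r \<longleftrightarrow>
     (\<forall>n. 0 < r n) \<and> r \<longlonglongrightarrow> 0 \<and>
     (\<forall>f \<in> KS_space m k p. \<exists>l<\<infinity>. (\<lambda>n. KS_J m k p (r n) f) \<longlonglongrightarrow> l)"

definition KS_energy ::
  "'a measure \<Rightarrow> (real \<Rightarrow> 'a \<times> 'a \<Rightarrow> ennreal) \<Rightarrow> real \<Rightarrow> (nat \<Rightarrow> real) \<Rightarrow> ('a \<Rightarrow> real) \<Rightarrow> real" where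
  "KS_energy m k p r f = enn2real (lim (\<lambda>n. KS_J m k p (r n) f))"

section \<open>Volume growth\<close>

definition volume_doubling :: "'a::metric_space measure \<Rightarrow> real \<Rightarrow> bool" where
  "volume_doubling m Q \<longleftrightarrow>
     (\<exists>C::real. 0 < C \<and> (\<forall>x r s. 0 < r \<and> r \<le> s \<longrightarrow>
        emeasure m (ball x s) \<le> ennreal (C * (s / r) powr Q) * emeasure m (ball x r) \<and>
        ennreal (C * (s / r) powr Q) * emeasure m (ball x r) < \<infinity>))"

text \<open>The diameter below is extended-valued, unlike \<^const>\<open>diameter\<close>, which is meaningful for bounded
  sets only.\<close>

definition ahlfors_regular :: "'a::metric_space measure \<Rightarrow> real \<Rightarrow> bool" where
  "ahlfors_regular m Q \<longleftrightarrow>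
     (\<exists>C::real. 1 \<le> C \<and> (\<forall>x s. 0 < s \<and> ereal s < 2 * (SUP (y::'a, z) \<in> UNIV. ereal (dist y z)) \<longrightarrow>
        ennreal (s powr Q / C) \<le> emeasure m (ball x s) \<and>
        emeasure m (ball x s) \<le> ennreal (C * s powr Q)))"

end

theory Submission
  imports Defs
begin

text \<open>
  Write \<open>F\<close> for the continuous functions of finite energy and \<open>E\<close> for the limit of the
  energies \<open>J\<close> along the chosen scales. Everything rests on two comparisons. Weak monotonicity
  gives \<open>E u \<le> sup J u \<le> W * E u\<close> on \<open>F\<close> (\<open>sup_le_E\<close>), the second
  inequality because the lower limit as the scale tends to 0 is at most the limit along any such sequence of
  scales. The Hoelder bound, whose exponent \<open>(\<beta> - Q) / p\<close> is positive, turns \<open>sup J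
  u\<close> into a bound for the oscillation of \<open>u\<close>. Together they give \<open>\<bar>u x - u
  y\<bar>\<^sup>p \<le> H\<^sup>p * W * d(x,y)\<^sup>\<beta>\<^sup>-\<^sup>Q * E u\<close>
  (\<open>E_hoelder\<close>), hence that only constants have zero energy, that the resistance is finite, and the
  upper resistance estimate, with constants that do not depend on the scales.

  The space \<open>K\<close> is bounded: an unbounded space carries balls far away from a fixed point which, by
  doubling, all have at least a fixed share of the mass of one ball, and a finite measure has no such mass at
  infinity (\<open>volume_doubling_finite_imp_bounded\<close>). So every function of \<open>F\<close> is
  bounded, and a function whose increments are dominated by those of members of \<open>F\<close> is in
  \<open>F\<close> again, integrability included (\<open>F_dominated\<close>).

  The energy at a fixed scale \<open>r\<close> is the \<open>p\<close>-th power of the \<open>L\<^sup>p\<close>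
  norm of the increment \<open>f(x) - f(y)\<close> with respect to the measure \<open>k\<^sub>r(x,y) m(dx)
  m(dy)\<close>. The contraction property is therefore a statement about \<open>L\<^sup>p\<close>: the mixed
  norms satisfy \<open>l\<^sup>q(L\<^sup>p) \<le> L\<^sup>p(l\<^sup>q)\<close> for \<open>q \<ge> p\<close> and
  \<open>L\<^sup>p(l\<^sup>q) \<le> l\<^sup>q(L\<^sup>p)\<close> for \<open>q \<le> p\<close>, and between the
  two one inserts the pointwise bound on the increments (\<open>lq_norm_Lp_contraction\<close>). It passes to
  the limit (\<open>E_contraction\<close>) since only finitely many functions are involved. The triangle
  inequality for \<open>E\<^sup>1\<^sup>/\<^sup>p\<close> is its instance for addition on the plane.

  For completeness, a sequence that is Cauchy in energy and normalised at one point is uniformly Cauchy by the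
  oscillation bound, and Fatou's lemma at each scale shows that its uniform limit is also its limit in energy
  (\<open>E_complete\<close>). Finally, truncated cutoff functions (\<open>F_cutoff\<close>) separate points,
  and when the measure is Ahlfors regular their energy is at most a multiple of
  \<open>d(x,y)\<^sup>Q\<^sup>-\<^sup>\<beta>\<close>, which is the lower resistance estimate.
\<close>

section \<open>Minkowski inequalities\<close>

text \<open>Unlike the open half-line, the closed one allows Jensen's inequality for functions with zeros.\<close>

lemma convex_on_powr_nonneg:
  assumes "1 \<le> (t::real)"
  shows "convex_on {0..} (\<lambda>x. x powr t)"
proof (rule convex_on_linorderI)
  show "convex {0::real..}" by (rule convex_real_interval)
next
  fix u x y :: real
  assume u: "0 < u" "u < 1" and xy: "x \<in> {0..}" "y \<in> {0..}" "x < y"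
  show "((1 - u) *\<^sub>R x + u *\<^sub>R y) powr t \<le> (1 - u) * x powr t + u * y powr t"
  proof (cases "x = 0")
    case True
    have "u powr t \<le> u" using u assms powr_mono'[of 1 t u] by simp
    with True u xy show ?thesis by (simp add: powr_mult mult_right_mono)
  next
    case False
    then have "x \<in> {0<..}" "y \<in> {0<..}" using xy by auto
    from convex_onD[OF powr_convex[OF assms] _ _ this, of u] u show ?thesis by simp
  qed
qed

lemma powr_weighted_sum_le:
  fixes w y :: "'i \<Rightarrow> real"
  assumes "1 \<le> t" "finite S" "(\<Sum>i\<in>S. w i) = 1" "\<And>i. i \<in> S \<Longrightarrow> 0 \<le> w i" "\<And>i. i \<in> S \<Longrightarrow> 0 \<le> y i"
  shows "(\<Sum>i\<in>S. w i * y i) powr t \<le> (\<Sum>i\<in>S. w i * y i powr t)"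
proof -
  have "S \<noteq> {}" using assms(3) by auto
  then show ?thesis
    using convex_on_sum[OF assms(2) _ convex_on_powr_nonneg[OF assms(1)], of w y] assms by auto
qed

text \<open>A crude bound, by the largest summand; it serves to establish integrability and finiteness,
  where the constant is irrelevant, and it covers exponents below 1.\<close>

lemma powr_sum_le:
  fixes y :: "'i \<Rightarrow> real"
  assumes "0 \<le> t" "finite S" "\<And>i. i \<in> S \<Longrightarrow> 0 \<le> y i"
  shows "(\<Sum>i\<in>S. y i) powr t \<le> real (card S) powr t * (\<Sum>i\<in>S. y i powr t)"
proof (cases "S = {}")
  case False
  define M where "M = Max (y ` S)"
  have M: "y i \<le> M" if "i \<in> S" for i using that assms(2) by (simp add: M_def)
  have "M \<in> y ` S" using False assms(2) by (simp add: M_def)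
  then obtain j where j: "j \<in> S" "M = y j" by auto
  have "(\<Sum>i\<in>S. y i) \<le> real (card S) * M" using sum_bounded_above[of S y M] M by simp
  then have "(\<Sum>i\<in>S. y i) powr t \<le> (real (card S) * M) powr t"
    using assms by (intro powr_mono2) (auto intro: sum_nonneg)
  also have "\<dots> = real (card S) powr t * M powr t" using j assms by (simp add: powr_mult)
  also have "M powr t \<le> (\<Sum>i\<in>S. y i powr t)"
    unfolding j(2) using j(1) assms by (intro member_le_sum) auto
  finally show ?thesis by (simp add: mult_left_mono)
qed simp

text \<open>With \<open>n i\<close> the norm of \<open>g i\<close> and \<open>T\<close> the sum of the norms, the function \<open>\<Sum>i. g i\<close> divided by \<open>T\<close>
  is an average, with weights \<open>n i / T\<close>, of functions of norm 1; convexity of the \<open>t\<close>-th power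
  shows that it has norm at most 1.\<close>

lemma Minkowski_integral:
  fixes g :: "'i \<Rightarrow> 'a \<Rightarrow> real"
  assumes t: "1 \<le> t" and S: "finite S"
    and meas: "\<And>i. i \<in> S \<Longrightarrow> g i \<in> borel_measurable N"
    and nonneg: "\<And>i z. i \<in> S \<Longrightarrow> 0 \<le> g i z"
    and int: "\<And>i. i \<in> S \<Longrightarrow> integrable N (\<lambda>z. g i z powr t)"
  shows "integrable N (\<lambda>z. (\<Sum>i\<in>S. g i z) powr t)"
    and "(\<integral>z. (\<Sum>i\<in>S. g i z) powr t \<partial>N) \<le> (\<Sum>i\<in>S. (\<integral>z. g i z powr t \<partial>N) powr (1 / t)) powr t"
proof -
  show I: "integrable N (\<lambda>z. (\<Sum>i\<in>S. g i z) powr t)"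
  proof (rule Bochner_Integration.integrable_bound)
    show "integrable N (\<lambda>z. real (card S) powr t * (\<Sum>i\<in>S. g i z powr t))" using int by simp
    show "(\<lambda>z. (\<Sum>i\<in>S. g i z) powr t) \<in> borel_measurable N" using meas by simp
    show "AE z in N. norm ((\<Sum>i\<in>S. g i z) powr t) \<le> norm (real (card S) powr t * (\<Sum>i\<in>S. g i z powr t))"
      using powr_sum_le[of t S "\<lambda>i. g i _"] nonneg S t by (simp add: sum_nonneg abs_mult)
  qed
  show "(\<integral>z. (\<Sum>i\<in>S. g i z) powr t \<partial>N) \<le> (\<Sum>i\<in>S. (\<integral>z. g i z powr t \<partial>N) powr (1 / t)) powr t"
  proof (cases "S = {}")
    case False
    define n where "n i = (\<integral>z. g i z powr t \<partial>N) powr (1 / t)" for i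
    have np: "n i powr t = (\<integral>z. g i z powr t \<partial>N)" if "i \<in> S" for i
      using t by (simp add: n_def powr_powr)
    \<comment> \<open>Enlarging each norm by \<open>e\<close> avoids division by zero; \<open>e\<close> then tends to 0.\<close>
    have bound: "(\<integral>z. (\<Sum>i\<in>S. g i z) powr t \<partial>N) \<le> (\<Sum>i\<in>S. n i + e) powr t" if e: "0 < e" for e
    proof -
      define T where "T = (\<Sum>i\<in>S. n i + e)"
      have ne: "0 < n i + e" for i using e by (simp add: n_def add_nonneg_pos)
      have T: "0 < T" unfolding T_def using S False ne by (intro sum_pos) auto
      have pt: "((\<Sum>i\<in>S. g i z) / T) powr t \<le> (\<Sum>i\<in>S. (n i + e) / T * (g i z powr t / (n i + e) powr t))" for z
      proof -
        have "(\<Sum>i\<in>S. g i z) / T = (\<Sum>i\<in>S. (n i + e) / T * (g i z / (n i + e)))"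
          using ne T unfolding sum_divide_distrib by (intro sum.cong) (auto simp: less_imp_neq[symmetric])
        also have "\<dots> powr t \<le> (\<Sum>i\<in>S. (n i + e) / T * (g i z / (n i + e)) powr t)"
          using t S ne T nonneg
          by (intro powr_weighted_sum_le) (auto simp: T_def sum_divide_distrib[symmetric] less_imp_le)
        also have "\<dots> = (\<Sum>i\<in>S. (n i + e) / T * (g i z powr t / (n i + e) powr t))"
          by (simp add: powr_divide)
        finally show ?thesis .
      qed
      have "(\<integral>z. (\<Sum>i\<in>S. g i z) powr t \<partial>N) / T powr t = (\<integral>z. ((\<Sum>i\<in>S. g i z) / T) powr t \<partial>N)"
        using T nonneg by (simp add: powr_divide sum_nonneg)
      also have "\<dots> \<le> (\<integral>z. (\<Sum>i\<in>S. (n i + e) / T * (g i z powr t / (n i + e) powr t)) \<partial>N)"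
        using T nonneg int I pt by (intro integral_mono) (auto simp: powr_divide sum_nonneg)
      also have "\<dots> = (\<Sum>i\<in>S. (n i + e) / T * (n i powr t / (n i + e) powr t))"
        using int np by (subst Bochner_Integration.integral_sum) auto
      also have "\<dots> \<le> (\<Sum>i\<in>S. (n i + e) / T * 1)"
      proof (intro sum_mono mult_left_mono)
        fix i
        have "n i powr t \<le> (n i + e) powr t" using e t by (intro powr_mono2) (auto simp: n_def)
        then show "n i powr t / (n i + e) powr t \<le> 1" using ne[of i] by simp
        show "0 \<le> (n i + e) / T" using ne[of i] T by simp
      qed
      also have "\<dots> = 1" using T by (simp add: T_def sum_divide_distrib[symmetric])
      finally show ?thesis using T by (simp add: T_def)
    qed
    have "((\<lambda>e. (\<Sum>i\<in>S. n i + e) powr t) \<longlongrightarrow> (\<Sum>i\<in>S. n i + 0) powr t) (at_right 0)"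
      using t by (intro tendsto_powr2 tendsto_sum tendsto_add tendsto_const tendsto_ident_at)
        (auto simp: eventually_at_right_less n_def intro!: eventually_at_rightI[of 0 1] sum_nonneg)
    moreover have "\<forall>\<^sub>F e in at_right 0. (\<integral>z. (\<Sum>i\<in>S. g i z) powr t \<partial>N) \<le> (\<Sum>i\<in>S. n i + e) powr t"
      using bound by (intro eventually_at_rightI[of 0 1]) auto
    ultimately have "(\<integral>z. (\<Sum>i\<in>S. g i z) powr t \<partial>N) \<le> (\<Sum>i\<in>S. n i + 0) powr t"
      by (rule tendsto_lowerbound) simp
    then show ?thesis by (simp add: n_def)
  qed simp
qed

text \<open>The triangle inequality for an integral with values in \<open>l\<^sup>s\<close>. Pairing the vector \<open>f z\<close> with the
  dual vector \<open>F\<^sup>s\<^sup>-\<^sup>1\<close> of the integral \<open>F\<close> costs at most the product of the norms, by convexity, and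
  integrating this pairing over \<open>z\<close> gives the \<open>s\<close>-th power of the norm of \<open>F\<close>.\<close>

lemma lp_norm_integral_le:
  fixes f :: "'i \<Rightarrow> 'a \<Rightarrow> real"
  assumes s: "1 \<le> s" and S: "finite S"
    and nonneg: "\<And>i z. i \<in> S \<Longrightarrow> 0 \<le> f i z"
    and int: "\<And>i. i \<in> S \<Longrightarrow> integrable N (f i)"
    and int': "integrable N (\<lambda>z. (\<Sum>i\<in>S. f i z powr s) powr (1 / s))"
  shows "(\<Sum>i\<in>S. (\<integral>z. f i z \<partial>N) powr s) powr (1 / s) \<le> (\<integral>z. (\<Sum>i\<in>S. f i z powr s) powr (1 / s) \<partial>N)"
proof -
  define F where "F i = (\<integral>z. f i z \<partial>N)" for i
  \<comment> \<open>Indices with vanishing integral are left out because the dual pairing divides by \<open>F i\<close>.\<close>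
  define P where "P = {i \<in> S. F i \<noteq> 0}"
  define T where "T = (\<Sum>i\<in>P. F i powr s)"
  have P: "finite P" "P \<subseteq> S" using S by (auto simp: P_def)
  have F0: "0 \<le> F i" if "i \<in> S" for i using that nonneg by (simp add: F_def)
  have Fpos: "0 < F i" if "i \<in> P" for i using that F0[of i] by (auto simp: P_def)
  have TS: "(\<Sum>i\<in>S. F i powr s) = T"
    unfolding T_def using S by (intro sum.mono_neutral_right) (auto simp: P_def)
  show ?thesis
  proof (cases "T = 0")
    case True
    then show ?thesis using TS by (simp add: F_def)
  next
    case False
    then have T: "0 < T" unfolding T_def by (metis powr_ge_zero sum_nonneg order_le_less)
    have pt: "(\<Sum>i\<in>P. F i powr (s - 1) * f i z) \<le> T powr (1 - 1 / s) * (\<Sum>i\<in>S. f i z powr s) powr (1 / s)" for z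
    proof -
      have nn: "0 \<le> (\<Sum>i\<in>P. F i powr s / T * (f i z / F i))"
        using Fpos T nonneg P by (intro sum_nonneg) (auto simp: less_imp_le)
      have "(\<Sum>i\<in>P. F i powr s / T * (f i z / F i)) powr s \<le> (\<Sum>i\<in>P. F i powr s / T * (f i z / F i) powr s)"
        using s P Fpos T nonneg
        by (intro powr_weighted_sum_le) (auto simp: T_def sum_divide_distrib[symmetric] less_imp_le)
      also have "\<dots> = (\<Sum>i\<in>P. f i z powr s) / T"
        unfolding sum_divide_distrib using Fpos nonneg P
        by (intro sum.cong) (auto simp: powr_divide less_imp_le less_imp_neq[symmetric] subset_iff)
      also have "\<dots> \<le> (\<Sum>i\<in>S. f i z powr s) / T"
        using T S P by (intro divide_right_mono sum_mono2) auto
      finally have "((\<Sum>i\<in>P. F i powr s / T * (f i z / F i)) powr s) powr (1 / s) \<le> ((\<Sum>i\<in>S. f i z powr s) / T) powr (1 / s)"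
        using s by (intro powr_mono2) auto
      then have "(\<Sum>i\<in>P. F i powr s / T * (f i z / F i)) \<le> (\<Sum>i\<in>S. f i z powr s) powr (1 / s) / T powr (1 / s)"
        using s nn T by (simp add: powr_powr powr_divide sum_nonneg)
      moreover have "(\<Sum>i\<in>P. F i powr s / T * (f i z / F i)) = (\<Sum>i\<in>P. F i powr (s - 1) * f i z) / T"
        unfolding sum_divide_distrib using Fpos by (intro sum.cong) (auto simp: powr_diff less_imp_le)
      ultimately have "(\<Sum>i\<in>P. F i powr (s - 1) * f i z) / T \<le> (\<Sum>i\<in>S. f i z powr s) powr (1 / s) / T powr (1 / s)"
        by simp
      then have "(\<Sum>i\<in>P. F i powr (s - 1) * f i z) \<le> (\<Sum>i\<in>S. f i z powr s) powr (1 / s) / T powr (1 / s) * T"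
        using T by (simp only: pos_divide_le_eq)
      also have "\<dots> = T powr (1 - 1 / s) * (\<Sum>i\<in>S. f i z powr s) powr (1 / s)"
        using T by (simp add: powr_diff)
      finally show ?thesis .
    qed
    have "T = (\<Sum>i\<in>P. F i powr (s - 1) * F i)"
      unfolding T_def using Fpos by (intro sum.cong) (auto simp: powr_diff less_imp_neq[symmetric] less_imp_le)
    also have "\<dots> = (\<integral>z. (\<Sum>i\<in>P. F i powr (s - 1) * f i z) \<partial>N)"
      using int P by (subst Bochner_Integration.integral_sum) (auto simp: F_def)
    also have "\<dots> \<le> (\<integral>z. T powr (1 - 1 / s) * (\<Sum>i\<in>S. f i z powr s) powr (1 / s) \<partial>N)"
      using int int' P pt
      by (intro integral_mono Bochner_Integration.integrable_sum integrable_mult_right) auto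
    finally have "T \<le> T powr (1 - 1 / s) * (\<integral>z. (\<Sum>i\<in>S. f i z powr s) powr (1 / s) \<partial>N)" by simp
    then show ?thesis using T TS by (simp add: F_def powr_diff field_simps)
  qed
qed

section \<open>Contractions between finite sequence spaces act on tuples of functions\<close>

lemma ereal_exponent_cases:
  fixes q :: ereal
  assumes "0 < q"
  obtains (real) r where "q = ereal r" "0 < r" | (infinity) "q = \<infinity>"
  using assms by (cases q) auto

lemma lq_norm_ereal: "lq_norm (ereal q) n x = (\<Sum>i<n. \<bar>x i\<bar> powr q) powr (1 / q)"
  by (simp add: lq_norm_def)

lemma lq_norm_infinity_le_iff:
  assumes "1 \<le> n"
  shows "lq_norm \<infinity> n x \<le> c \<longleftrightarrow> (\<forall>i<n. \<bar>x i\<bar> \<le> c)"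
  using assms by (auto simp: lq_norm_def lessThan_empty_iff)

lemma lq_norm_nonneg: "1 \<le> n \<Longrightarrow> 0 \<le> lq_norm q n x"
  by (auto simp: lq_norm_def lessThan_empty_iff Max_ge_iff intro!: exI[of _ 0])

lemma lq_norm_cong:
  assumes "\<And>i. i < n \<Longrightarrow> x i = y i"
  shows "lq_norm q n x = lq_norm q n y"
proof -
  have "(\<lambda>i. \<bar>x i\<bar>) ` {..<n} = (\<lambda>i. \<bar>y i\<bar>) ` {..<n}" using assms by (intro image_cong) auto
  then show ?thesis using assms by (simp add: lq_norm_def)
qed

lemma abs_le_lq_norm:
  assumes "0 < q" "i < n"
  shows "\<bar>x i\<bar> \<le> lq_norm q n x"
  using assms(1)
proof (cases rule: ereal_exponent_cases)
  case (real r)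
  have "\<bar>x i\<bar> = (\<bar>x i\<bar> powr r) powr (1 / r)" using real by (simp add: powr_powr)
  also have "\<dots> \<le> (\<Sum>i<n. \<bar>x i\<bar> powr r) powr (1 / r)"
    using real assms(2) by (intro powr_mono2 member_le_sum) auto
  finally show ?thesis by (simp add: real lq_norm_ereal)
qed (use assms(2) in \<open>simp add: lq_norm_def\<close>)

lemma lq_norm_le_sum:
  assumes "0 < q"
  shows "lq_norm (ereal q) n x \<le> real n powr (1 / q) * (\<Sum>i<n. \<bar>x i\<bar>)"
proof -
  have "(\<Sum>i<n. \<bar>x i\<bar> powr q) powr (1 / q) \<le> real (card {..<n}) powr (1 / q) * (\<Sum>i<n. (\<bar>x i\<bar> powr q) powr (1 / q))"
    using assms by (intro powr_sum_le) auto
  then show ?thesis using assms by (simp add: lq_norm_ereal powr_powr)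
qed

lemma lq_norm_tendsto:
  assumes "0 < q" and "\<And>i. i < n \<Longrightarrow> ((\<lambda>j. x j i) \<longlongrightarrow> y i) F"
  shows "((\<lambda>j. lq_norm (ereal q) n (x j)) \<longlongrightarrow> lq_norm (ereal q) n y) F"
  unfolding lq_norm_ereal using assms
  by (intro tendsto_powr2 tendsto_sum tendsto_rabs tendsto_const) (auto intro!: sum_nonneg always_eventually)

lemma lq_norm_le_limit:
  assumes q1: "0 < q1" and q2: "0 < q2" and n: "1 \<le> n2"
    and x: "\<And>i. i < n2 \<Longrightarrow> (\<lambda>j. x j i) \<longlonglongrightarrow> x' i"
    and y: "\<And>i. i < n1 \<Longrightarrow> (\<lambda>j. y j i) \<longlonglongrightarrow> y' i"
    and le: "\<And>j. lq_norm q2 n2 (x j) \<le> lq_norm (ereal q1) n1 (y j)"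
  shows "lq_norm q2 n2 x' \<le> lq_norm (ereal q1) n1 y'"
  using q2
proof (cases rule: ereal_exponent_cases)
  case (real r)
  show ?thesis
    using lq_norm_tendsto[of r n2 x x' sequentially] lq_norm_tendsto[of q1 n1 y y' sequentially] real q1 x y le
    by (intro LIMSEQ_le[of "\<lambda>j. lq_norm q2 n2 (x j)" _ "\<lambda>j. lq_norm q1 n1 (y j)"]) auto
next
  case infinity
  have "\<bar>x' i\<bar> \<le> lq_norm q1 n1 y'" if i: "i < n2" for i
  proof (rule LIMSEQ_le)
    show "(\<lambda>j. \<bar>x j i\<bar>) \<longlonglongrightarrow> \<bar>x' i\<bar>" using x[OF i] by (rule tendsto_rabs)
    show "(\<lambda>j. lq_norm q1 n1 (y j)) \<longlonglongrightarrow> lq_norm q1 n1 y'" using q1 y by (rule lq_norm_tendsto)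
    show "\<exists>N. \<forall>j\<ge>N. \<bar>x j i\<bar> \<le> lq_norm q1 n1 (y j)"
      using le i infinity n by (auto simp: lq_norm_infinity_le_iff)
  qed
  then show ?thesis using infinity n by (simp add: lq_norm_infinity_le_iff)
qed

text \<open>The pointwise \<open>l\<^sup>q\<close> norm of \<open>b\<close> is compared with the mixed norms from both sides: Minkowski's
  inequality with exponent \<open>p / q1\<close> bounds its \<open>L\<^sup>p\<close> norm from above by the right-hand side, and the
  integral triangle inequality with exponent \<open>q2 / p\<close> bounds the left-hand side by the \<open>L\<^sup>p\<close> norm of
  the pointwise norm of \<open>a\<close>. The conditions on the exponents say that both of these are at least 1.\<close>

lemma lq_norm_Lp_contraction:
  fixes a b :: "nat \<Rightarrow> 'z \<Rightarrow> real"
  assumes p: "1 \<le> p" and q1: "0 < q1" "q1 \<le> p" and q2: "ereal p \<le> q2" and n2: "1 \<le> n2"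
    and a: "\<And>l. l < n2 \<Longrightarrow> a l \<in> borel_measurable N"
    and b: "\<And>i. i < n1 \<Longrightarrow> b i \<in> borel_measurable N"
    and int: "\<And>i. i < n1 \<Longrightarrow> integrable N (\<lambda>z. \<bar>b i z\<bar> powr p)"
    and le: "\<And>z. lq_norm q2 n2 (\<lambda>l. a l z) \<le> lq_norm (ereal q1) n1 (\<lambda>i. b i z)"
  shows "lq_norm q2 n2 (\<lambda>l. (\<integral>z. \<bar>a l z\<bar> powr p \<partial>N) powr (1 / p))
    \<le> lq_norm (ereal q1) n1 (\<lambda>i. (\<integral>z. \<bar>b i z\<bar> powr p \<partial>N) powr (1 / p))"
proof -
  define \<phi> where "\<phi> z = lq_norm (ereal q1) n1 (\<lambda>i. b i z) powr p" for z
  have q2pos: "0 < q2" using p q2 by (cases q2) auto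
  have \<phi>: "\<phi> z = (\<Sum>i<n1. \<bar>b i z\<bar> powr q1) powr (p / q1)" for z
    by (simp add: \<phi>_def lq_norm_ereal powr_powr)
  have b': "integrable N (\<lambda>z. (\<bar>b i z\<bar> powr q1) powr (p / q1))" if "i \<in> {..<n1}" for i
    using int[of i] q1 that by (simp add: powr_powr)
  have \<phi>_int: "integrable N \<phi>"
    unfolding \<phi> using q1 b b' by (intro Minkowski_integral(1)) auto
  have "(\<integral>z. \<phi> z \<partial>N) \<le> (\<Sum>i<n1. (\<integral>z. (\<bar>b i z\<bar> powr q1) powr (p / q1) \<partial>N) powr (1 / (p / q1))) powr (p / q1)"
    unfolding \<phi> using q1 b b' by (intro Minkowski_integral(2)) auto
  also have "\<dots> = lq_norm (ereal q1) n1 (\<lambda>i. (\<integral>z. \<bar>b i z\<bar> powr p \<partial>N) powr (1 / p)) powr p"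
    using p q1 by (simp add: lq_norm_ereal powr_powr)
  finally have "(\<integral>z. \<phi> z \<partial>N) powr (1 / p)
      \<le> (lq_norm (ereal q1) n1 (\<lambda>i. (\<integral>z. \<bar>b i z\<bar> powr p \<partial>N) powr (1 / p)) powr p) powr (1 / p)"
    using p by (intro powr_mono2) (auto simp: \<phi>)
  also have "\<dots> = lq_norm (ereal q1) n1 (\<lambda>i. (\<integral>z. \<bar>b i z\<bar> powr p \<partial>N) powr (1 / p))"
    using p by (simp add: powr_powr lq_norm_ereal)
  finally have rhs: "(\<integral>z. \<phi> z \<partial>N) powr (1 / p) \<le> lq_norm (ereal q1) n1 (\<lambda>i. (\<integral>z. \<bar>b i z\<bar> powr p \<partial>N) powr (1 / p))" .
  have a\<phi>: "\<bar>a l z\<bar> powr p \<le> \<phi> z" if "l < n2" for l z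
    unfolding \<phi>_def using p abs_le_lq_norm[OF q2pos that, of "\<lambda>l. a l z"] le[of z]
    by (intro powr_mono2) auto
  have a_int: "integrable N (\<lambda>z. \<bar>a l z\<bar> powr p)" if l: "l < n2" for l
    using a[OF l] a\<phi>[OF l] by (intro Bochner_Integration.integrable_bound[OF \<phi>_int]) (auto simp: \<phi>)
  show ?thesis
    using q2pos
  proof (cases rule: ereal_exponent_cases)
    case (real r)
    then have r: "p \<le> r" using q2 by simp
    have eq: "(\<Sum>l<n2. (\<bar>a l z\<bar> powr p) powr (r / p)) powr (1 / (r / p)) = lq_norm q2 n2 (\<lambda>l. a l z) powr p" for z
      using p real by (simp add: lq_norm_ereal powr_powr)
    have le\<phi>: "(\<Sum>l<n2. (\<bar>a l z\<bar> powr p) powr (r / p)) powr (1 / (r / p)) \<le> \<phi> z" for z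
      unfolding eq \<phi>_def using p le n2 by (intro powr_mono2) (auto intro: lq_norm_nonneg)
    have int': "integrable N (\<lambda>z. (\<Sum>l<n2. (\<bar>a l z\<bar> powr p) powr (r / p)) powr (1 / (r / p)))"
      using a le\<phi> by (intro Bochner_Integration.integrable_bound[OF \<phi>_int]) (auto simp: \<phi>)
    have "lq_norm q2 n2 (\<lambda>l. (\<integral>z. \<bar>a l z\<bar> powr p \<partial>N) powr (1 / p))
        = ((\<Sum>l<n2. (\<integral>z. \<bar>a l z\<bar> powr p \<partial>N) powr (r / p)) powr (1 / (r / p))) powr (1 / p)"
      using p real by (simp add: lq_norm_ereal powr_powr)
    also have "\<dots> \<le> (\<integral>z. (\<Sum>l<n2. (\<bar>a l z\<bar> powr p) powr (r / p)) powr (1 / (r / p)) \<partial>N) powr (1 / p)"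
      using p r a_int int' by (intro powr_mono2 lp_norm_integral_le) auto
    also have "\<dots> \<le> (\<integral>z. \<phi> z \<partial>N) powr (1 / p)"
      using p le\<phi> int' \<phi>_int by (intro powr_mono2 integral_mono) (auto intro!: integral_nonneg)
    finally show ?thesis using rhs by simp
  next
    case infinity
    have "(\<integral>z. \<bar>a l z\<bar> powr p \<partial>N) powr (1 / p) \<le> (\<integral>z. \<phi> z \<partial>N) powr (1 / p)" if l: "l < n2" for l
      using p l a_int \<phi>_int a\<phi> by (intro powr_mono2 integral_mono) auto
    then show ?thesis using rhs infinity n2 by (fastforce simp: lq_norm_infinity_le_iff)
  qed
qed

section \<open>Separable spaces and finite doubling measures\<close>

text \<open>Products of balls with centres in a countable dense set and radii \<open>1 / n\<close> form a countable base, so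
  each open set of the product is a countable union of measurable rectangles.\<close>

lemma sets_pair_borel_separable:
  assumes "separable_space (euclidean :: 'a::metric_space topology)"
  shows "sets (borel \<Otimes>\<^sub>M borel) = sets (borel :: ('a \<times> 'a) measure)"
proof
  obtain D :: "'a set" where D: "countable D" "closure D = UNIV"
    using assms by (auto simp: separable_space_def)
  have "open U \<Longrightarrow> U \<in> sets (borel \<Otimes>\<^sub>M borel)" for U :: "('a \<times> 'a) set"
  proof -
    assume U: "open U"
    define I where "I = {(a, b, n). a \<in> D \<and> b \<in> D \<and> ball a (1 / Suc n) \<times> ball b (1 / Suc n) \<subseteq> U}"
    have "I \<subseteq> D \<times> D \<times> UNIV" by (auto simp: I_def)
    then have I: "countable I" using D by (meson countable_SIGMA countable_subset countableI_type)
    have "U = (\<Union>(a, b, n)\<in>I. ball a (1 / Suc n) \<times> ball b (1 / Suc n))"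
    proof (intro equalityI subsetI)
      fix z assume z: "z \<in> U"
      obtain x y where xy: "z = (x, y)" by (cases z)
      obtain A B where AB: "open A" "open B" "x \<in> A" "y \<in> B" "A \<times> B \<subseteq> U"
        using open_prod_elim[OF U z] unfolding xy by (metis mem_Sigma_iff)
      obtain e1 where e1: "0 < e1" "ball x e1 \<subseteq> A" using AB open_contains_ball by blast
      obtain e2 where e2: "0 < e2" "ball y e2 \<subseteq> B" using AB open_contains_ball by blast
      obtain n where n: "1 / Suc n < min e1 e2 / 2"
        using reals_Archimedean[of "min e1 e2 / 2"] e1 e2 by (auto simp: inverse_eq_divide)
      have pos: "0 < 1 / real (Suc n)" by simp
      obtain a where a: "a \<in> D" "dist a x < 1 / Suc n"
        using closure_approachableD[of x D "1 / Suc n"] D pos by (auto simp: dist_commute)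
      obtain b where b: "b \<in> D" "dist b y < 1 / Suc n"
        using closure_approachableD[of y D "1 / Suc n"] D pos by (auto simp: dist_commute)
      have "ball a (1 / Suc n) \<subseteq> ball x e1"
      proof
        fix w assume "w \<in> ball a (1 / Suc n)"
        then show "w \<in> ball x e1"
          using a(2) n dist_triangle[of x w a] by (simp add: dist_commute)
      qed
      moreover have "ball b (1 / Suc n) \<subseteq> ball y e2"
      proof
        fix w assume "w \<in> ball b (1 / Suc n)"
        then show "w \<in> ball y e2"
          using b(2) n dist_triangle[of y w b] by (simp add: dist_commute)
      qed
      ultimately have "ball a (1 / Suc n) \<times> ball b (1 / Suc n) \<subseteq> U" using e1 e2 AB by blast
      then have "(a, b, n) \<in> I" using a b by (simp add: I_def)
      moreover have "z \<in> ball a (1 / Suc n) \<times> ball b (1 / Suc n)"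
        using xy a b by (simp add: dist_commute)
      ultimately show "z \<in> (\<Union>(a, b, n)\<in>I. ball a (1 / Suc n) \<times> ball b (1 / Suc n))" by blast
    qed (auto simp: I_def)
    moreover have "(\<Union>(a, b, n)\<in>I. ball a (1 / Suc n) \<times> ball b (1 / Suc n)) \<in> sets (borel \<Otimes>\<^sub>M borel)"
      using I by (intro sets.countable_UN') (auto intro!: pair_measureI)
    ultimately show ?thesis by simp
  qed
  then have "sigma_sets UNIV {U :: ('a \<times> 'a) set. open U} \<subseteq> sets (borel \<Otimes>\<^sub>M borel)"
    by (intro sets.sigma_sets_subset') auto
  then show "sets (borel :: ('a \<times> 'a) measure) \<subseteq> sets (borel \<Otimes>\<^sub>M borel)"
    by (simp add: borel_def)
  have "A \<times> B \<in> sets borel" if "A \<in> sets borel" "B \<in> sets borel" for A B :: "'a set"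
  proof -
    have "fst -` A \<inter> space borel \<in> sets (borel :: ('a \<times> 'a) measure)"
      by (rule measurable_sets[OF borel_measurable_continuous_onI that(1)]) (intro continuous_intros)
    moreover have "snd -` B \<inter> space borel \<in> sets (borel :: ('a \<times> 'a) measure)"
      by (rule measurable_sets[OF borel_measurable_continuous_onI that(2)]) (intro continuous_intros)
    ultimately have "(fst -` A \<inter> space borel) \<inter> (snd -` B \<inter> space borel) \<in> sets (borel :: ('a \<times> 'a) measure)"
      by (rule sets.Int)
    also have "(fst -` A \<inter> space borel) \<inter> (snd -` B \<inter> space borel) = A \<times> B" by auto
    finally show ?thesis .
  qed
  then have "sigma_sets UNIV {A \<times> B |A B. A \<in> sets (borel :: 'a measure) \<and> B \<in> sets (borel :: 'a measure)}
      \<subseteq> sets (borel :: ('a \<times> 'a) measure)"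
    by (intro sets.sigma_sets_subset') auto
  then show "sets (borel \<Otimes>\<^sub>M borel) \<subseteq> sets (borel :: ('a \<times> 'a) measure)"
    by (simp add: sets_pair_measure)
qed

text \<open>If \<open>d(x0,x) = d\<close> is large, then \<open>ball x (2 * d)\<close> contains the unit ball about \<open>x0\<close>, while
  \<open>ball x (d / 2)\<close> avoids a large ball about \<open>x0\<close>; doubling makes their masses comparable. The mass
  outside large balls would thus stay away from 0, which is impossible for a finite measure.\<close>

lemma volume_doubling_finite_imp_bounded:
  fixes m :: "'a::metric_space measure"
  assumes borel: "sets m = sets borel" and finite: "emeasure m UNIV < \<infinity>"
    and full_support: "\<And>U. open U \<Longrightarrow> U \<noteq> {} \<Longrightarrow> 0 < emeasure m U"
    and doubling: "volume_doubling m Q"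
  shows "bounded (UNIV :: 'a set)"
proof (rule ccontr)
  assume unbounded: "\<not> bounded (UNIV :: 'a set)"
  have [measurable_cong]: "sets m = sets borel" by (fact borel)
  obtain C where C: "0 < C" and D: "\<And>x r s. 0 < r \<Longrightarrow> r \<le> s \<Longrightarrow>
      emeasure m (ball x s) \<le> ennreal (C * (s / r) powr Q) * emeasure m (ball x r)"
    using doubling by (auto simp: volume_doubling_def)
  fix x0 :: 'a
  define c where "c = emeasure m (ball x0 1)"
  have c: "0 < c" unfolding c_def by (intro full_support) auto
  have far: "c \<le> ennreal (C * 4 powr Q) * emeasure m (- ball x0 (real n))" for n
  proof -
    obtain x where x: "2 * real n + 2 < dist x0 x"
      using unbounded by (metis UNIV_I bounded_def not_le)
    define d where "d = dist x0 x"
    have d: "2 * real n + 2 < d" using x by (simp add: d_def)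
    have "c \<le> emeasure m (ball x (2 * d))"
      unfolding c_def
    proof (rule emeasure_mono)
      show "ball x0 1 \<subseteq> ball x (2 * d)"
      proof
        fix y assume "y \<in> ball x0 1"
        then show "y \<in> ball x (2 * d)"
          using d dist_triangle[of x y x0] by (simp add: d_def dist_commute)
      qed
    qed simp
    also have "\<dots> \<le> ennreal (C * (2 * d / (d / 2)) powr Q) * emeasure m (ball x (d / 2))"
      using d by (intro D) auto
    also have "2 * d / (d / 2) = 4" using d by simp
    also have "emeasure m (ball x (d / 2)) \<le> emeasure m (- ball x0 (real n))"
    proof (rule emeasure_mono)
      show "ball x (d / 2) \<subseteq> - ball x0 (real n)"
      proof
        fix y assume "y \<in> ball x (d / 2)"
        then show "y \<in> - ball x0 (real n)"
          using d dist_triangle[of x0 x y] by (simp add: d_def dist_commute)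
      qed
    qed simp
    finally show ?thesis by (simp add: mult_left_mono)
  qed
  have "(\<lambda>n. emeasure m (- ball x0 (real n))) \<longlonglongrightarrow> emeasure m (\<Inter>n. - ball x0 (real n))"
  proof (rule Lim_emeasure_decseq)
    show "decseq (\<lambda>n. - ball x0 (real n))" by (auto simp: decseq_def)
    show "emeasure m (- ball x0 (real n)) \<noteq> \<infinity>" for n
      using finite emeasure_mono[of "- ball x0 (real n)" UNIV m] by (auto simp: top_unique)
  qed auto
  moreover have "(\<Inter>n. - ball x0 (real n)) = {}"
  proof -
    have "y \<notin> (\<Inter>n. - ball x0 (real n))" for y
      using reals_Archimedean2[of "dist x0 y"] by auto
    then show ?thesis by blast
  qed
  ultimately have "(\<lambda>n. ennreal (C * 4 powr Q) * emeasure m (- ball x0 (real n))) \<longlonglongrightarrow> ennreal (C * 4 powr Q) * 0"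
    by (intro ennreal_tendsto_cmult) auto
  then have "c \<le> ennreal (C * 4 powr Q) * 0" using far by (intro LIMSEQ_le_const) auto
  then show False using c by simp
qed

section \<open>The quotient of a seminormed function space by the constants\<close>

locale seminorm_mod_constants =
  fixes p :: real and E :: "('a \<Rightarrow> real) \<Rightarrow> real" and F :: "('a \<Rightarrow> real) set"
  assumes constants: "constants \<subseteq> F"
    and add: "\<And>u v. u \<in> F \<Longrightarrow> v \<in> F \<Longrightarrow> (\<lambda>x. u x + v x) \<in> F"
    and scale: "\<And>a u. u \<in> F \<Longrightarrow> (\<lambda>x. a * u x) \<in> F"
    and homogeneous: "\<And>a u. u \<in> F \<Longrightarrow> E (\<lambda>x. a * u x) powr (1 / p) = \<bar>a\<bar> * E u powr (1 / p)"
    and triangle: "\<And>u v. u \<in> F \<Longrightarrow> v \<in> F \<Longrightarrow>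
      E (\<lambda>x. u x + v x) powr (1 / p) \<le> E u powr (1 / p) + E v powr (1 / p)"
    and kernel: "{u \<in> F. E u = 0} = constants"
begin

lemma diff: "u \<in> F \<Longrightarrow> v \<in> F \<Longrightarrow> (\<lambda>x. u x - v x) \<in> F"
  using add[of u "\<lambda>x. -1 * v x"] scale[of v "-1"] by simp

lemma seminorm_eq_0_iff: "u \<in> F \<Longrightarrow> E u powr (1 / p) = 0 \<longleftrightarrow> u \<in> constants"
  using kernel by auto

lemma seminorm_minus_commute:
  assumes "u \<in> F" "v \<in> F"
  shows "E (\<lambda>x. u x - v x) powr (1 / p) = E (\<lambda>x. v x - u x) powr (1 / p)"
  using homogeneous[OF diff[OF assms], of "-1"] by simp

lemma seminorm_diff_triangle:
  assumes "u \<in> F" "v \<in> F" "w \<in> F"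
  shows "E (\<lambda>x. u x - w x) powr (1 / p) \<le> E (\<lambda>x. u x - v x) powr (1 / p) + E (\<lambda>x. v x - w x) powr (1 / p)"
  using triangle[OF diff[OF assms(1,2)] diff[OF assms(2,3)]] by simp

definition coset :: "('a \<Rightarrow> real) \<Rightarrow> ('a \<Rightarrow> real) set" where
  "coset u = {v \<in> F. (\<lambda>x. u x - v x) \<in> constants}"

lemma mod_constants_eq: "mod_constants F = coset ` F"
  by (auto simp: mod_constants_def coset_def quotient_def)

lemma coset_eqI:
  assumes "(\<lambda>x. u x - v x) \<in> constants"
  shows "coset u = coset v"
proof -
  obtain c where c: "u = (\<lambda>x. v x + c)" using assms by (force simp: fun_eq_iff algebra_simps)
  have "(\<lambda>x. u x - w x) \<in> constants \<longleftrightarrow> (\<lambda>x. v x - w x) \<in> constants" for w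
  proof
    assume "(\<lambda>x. u x - w x) \<in> constants"
    then obtain d where "\<forall>x. u x - w x = d" by (auto simp: fun_eq_iff)
    then have "(\<lambda>x. v x - w x) = (\<lambda>_. d - c)" by (auto simp: c fun_eq_iff algebra_simps)
    then show "(\<lambda>x. v x - w x) \<in> constants" by simp
  next
    assume "(\<lambda>x. v x - w x) \<in> constants"
    then obtain d where "\<forall>x. v x - w x = d" by (auto simp: fun_eq_iff)
    then have "(\<lambda>x. u x - w x) = (\<lambda>_. d + c)" by (auto simp: c fun_eq_iff algebra_simps)
    then show "(\<lambda>x. u x - w x) \<in> constants" by simp
  qed
  then show ?thesis by (simp add: coset_def)
qed

lemma self_in_coset: "u \<in> F \<Longrightarrow> u \<in> coset u"
  by (simp add: coset_def)

text \<open>The representative that \<^const>\<open>quotient_dist\<close> selects.\<close>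

definition rep :: "('a \<Rightarrow> real) set \<Rightarrow> 'a \<Rightarrow> real" where
  "rep U = (SOME u. u \<in> U)"

lemma rep_in:
  assumes "U \<in> mod_constants F"
  shows "rep U \<in> F" and "coset (rep U) = U"
proof -
  obtain u where u: "u \<in> F" "U = coset u" using assms by (auto simp: mod_constants_eq)
  have "u \<in> U" using self_in_coset u by simp
  then have *: "rep U \<in> U" unfolding rep_def by (rule someI[of "\<lambda>v. v \<in> U"])
  then show "rep U \<in> F" using u by (simp add: coset_def)
  show "coset (rep U) = U" using * coset_eqI[of u "rep U"] u by (simp add: coset_def)
qed

lemma quotient_dist_rep:
  assumes "U \<in> mod_constants F" "V \<in> mod_constants F"
  shows "quotient_dist p E F U V = E (\<lambda>x. rep U x - rep V x) powr (1 / p)"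
  using assms by (simp add: quotient_dist_def rep_def)

lemma quotient_Metric_space: "Metric_space (mod_constants F) (quotient_dist p E F)"
proof
  show "0 \<le> quotient_dist p E F U V" for U V by (simp add: quotient_dist_def)
  show "quotient_dist p E F U V = quotient_dist p E F V U" for U V
  proof (cases "U \<in> mod_constants F \<and> V \<in> mod_constants F")
    case True
    then show ?thesis by (simp add: quotient_dist_rep seminorm_minus_commute[of "rep U"] rep_in)
  qed (auto simp: quotient_dist_def)
next
  fix U V assume UV: "U \<in> mod_constants F" "V \<in> mod_constants F"
  have "quotient_dist p E F U V = 0 \<longleftrightarrow> (\<lambda>x. rep U x - rep V x) \<in> constants"
    unfolding quotient_dist_rep[OF UV] using UV by (intro seminorm_eq_0_iff diff rep_in)
  also have "\<dots> \<longleftrightarrow> U = V"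
  proof
    show "U = V" if "(\<lambda>x. rep U x - rep V x) \<in> constants"
      using coset_eqI[OF that] UV by (simp add: rep_in)
  qed auto
  finally show "quotient_dist p E F U V = 0 \<longleftrightarrow> U = V" .
next
  fix U V W assume "U \<in> mod_constants F" "V \<in> mod_constants F" "W \<in> mod_constants F"
  then show "quotient_dist p E F U W \<le> quotient_dist p E F U V + quotient_dist p E F V W"
    by (simp add: quotient_dist_rep rep_in seminorm_diff_triangle)
qed

text \<open>Representatives of the limit coset differ by a constant, which has seminorm 0; so convergence of
  representatives to any one limit function suffices.\<close>

lemma quotient_mcomplete:
  assumes complete: "\<And>u. (\<And>n. u n \<in> F) \<Longrightarrow>
      (\<And>e. 0 < e \<Longrightarrow> \<exists>N. \<forall>i\<ge>N. \<forall>j\<ge>N. E (\<lambda>x. u i x - u j x) powr (1 / p) < e) \<Longrightarrow>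
      \<exists>v\<in>F. (\<lambda>n. E (\<lambda>x. u n x - v x) powr (1 / p)) \<longlonglongrightarrow> 0"
  shows "Metric_space.mcomplete (mod_constants F) (quotient_dist p E F)"
proof -
  interpret Metric_space "mod_constants F" "quotient_dist p E F" by (rule quotient_Metric_space)
  show ?thesis
    unfolding mcomplete_def
  proof (intro allI impI)
    fix \<sigma> :: "nat \<Rightarrow> ('a \<Rightarrow> real) set"
    assume cauchy: "MCauchy \<sigma>"
    then have \<sigma>: "\<sigma> n \<in> mod_constants F" for n by (auto simp: MCauchy_def)
    have "\<exists>v\<in>F. (\<lambda>n. E (\<lambda>x. rep (\<sigma> n) x - v x) powr (1 / p)) \<longlonglongrightarrow> 0"
    proof (rule complete)
      fix e :: real assume "0 < e"
      then obtain N where "\<forall>i j. N \<le> i \<longrightarrow> N \<le> j \<longrightarrow> quotient_dist p E F (\<sigma> i) (\<sigma> j) < e"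
        using cauchy unfolding MCauchy_def by blast
      then show "\<exists>N. \<forall>i\<ge>N. \<forall>j\<ge>N. E (\<lambda>x. rep (\<sigma> i) x - rep (\<sigma> j) x) powr (1 / p) < e"
        using \<sigma> by (auto simp: quotient_dist_rep)
    qed (use \<sigma> rep_in in auto)
    then obtain v where v: "v \<in> F" "(\<lambda>n. E (\<lambda>x. rep (\<sigma> n) x - v x) powr (1 / p)) \<longlonglongrightarrow> 0" by blast
    define V where "V = coset v"
    have V: "V \<in> mod_constants F" using v by (simp add: V_def mod_constants_eq)
    have "v \<in> coset (rep V)" using rep_in(2)[OF V] self_in_coset[OF v(1)] by (simp add: V_def)
    then have "(\<lambda>x. rep V x - v x) \<in> constants" by (simp add: coset_def)
    then have "E (\<lambda>x. v x - rep V x) powr (1 / p) = 0"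
      using seminorm_eq_0_iff[OF diff[OF rep_in(1)[OF V] v(1)]] seminorm_minus_commute[OF v(1) rep_in(1)[OF V]]
      by simp
    then have le: "quotient_dist p E F (\<sigma> n) V \<le> E (\<lambda>x. rep (\<sigma> n) x - v x) powr (1 / p)" for n
      using seminorm_diff_triangle[OF rep_in(1)[OF \<sigma>] v(1) rep_in(1)[OF V], of n]
      by (simp add: quotient_dist_rep \<sigma> V)
    have "limitin mtopology \<sigma> V sequentially"
      unfolding limit_metric_sequentially
    proof (intro conjI allI impI V)
      fix e :: real assume "0 < e"
      from order_tendstoD(2)[OF v(2) this] obtain N where
        "\<forall>n\<ge>N. E (\<lambda>x. rep (\<sigma> n) x - v x) powr (1 / p) < e"
        by (auto simp: eventually_sequentially)
      then show "\<exists>N. \<forall>n\<ge>N. \<sigma> n \<in> mod_constants F \<and> quotient_dist p E F (\<sigma> n) V < e"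
        using le \<sigma> by (meson le_less_trans)
    qed
    then show "\<exists>V. limitin mtopology \<sigma> V sequentially" ..
  qed
qed

end

section \<open>Energies at a fixed scale as powers of Lebesgue norms\<close>

locale jump_kernel =
  fixes m :: "'a::metric_space measure" and k :: "real \<Rightarrow> 'a \<times> 'a \<Rightarrow> ennreal" and p :: real
  assumes p: "1 \<le> p"
    and separable: "separable_space (euclidean :: 'a topology)"
    and sets_m: "sets m = sets borel"
    and finite_m: "emeasure m UNIV < \<infinity>"
    and kernel: "\<And>r. 0 < r \<Longrightarrow> k r \<in> borel_measurable borel"
begin

lemma space_m: "space m = UNIV"
  using sets_eq_imp_space_eq[OF sets_m] by simp

lemma continuous_measurable:
  fixes f :: "'a \<Rightarrow> real"
  shows "continuous_on UNIV f \<Longrightarrow> f \<in> borel_measurable m"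
  using borel_measurable_continuous_onI[of f] by (simp cong: measurable_cong_sets add: sets_m)

lemma kernel_measurable: "0 < r \<Longrightarrow> k r \<in> borel_measurable (m \<Otimes>\<^sub>M m)"
  using kernel[of r] sets_pair_borel_separable[OF separable]
  by (simp add: measurable_cong_sets[OF sets_pair_measure_cong[OF sets_m sets_m] refl]
      measurable_cong_sets[OF sets_pair_borel_separable[OF separable] refl])

text \<open>With respect to this measure the energy at scale \<open>r\<close> is the \<open>p\<close>-th power of the \<open>L\<^sup>p\<close> norm of the
  increment, so that inequalities between \<open>L\<^sup>p\<close> norms become inequalities between energies.\<close>

definition jump_measure :: "real \<Rightarrow> ('a \<times> 'a) measure" where
  "jump_measure r = density (m \<Otimes>\<^sub>M m) (k r)"

definition increment :: "('a \<Rightarrow> real) \<Rightarrow> 'a \<times> 'a \<Rightarrow> real" where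
  "increment f z = f (fst z) - f (snd z)"

lemma increment_measurable:
  assumes "f \<in> borel_measurable m"
  shows "increment f \<in> borel_measurable (jump_measure r)"
proof -
  have [measurable]: "f \<in> borel_measurable m" by (fact assms)
  show ?thesis unfolding increment_def[abs_def] jump_measure_def by measurable
qed

lemma KS_J_eq_jump_integral:
  assumes f: "f \<in> borel_measurable m" and r: "0 < r"
  shows "KS_J m k p r f = (\<integral>\<^sup>+ z. ennreal (\<bar>increment f z\<bar> powr p) \<partial>jump_measure r)"
proof -
  interpret finite_measure m using finite_m by (intro finite_measureI) (simp add: space_m)
  have [measurable]: "f \<in> borel_measurable m" "k r \<in> borel_measurable (m \<Otimes>\<^sub>M m)"
    using f kernel_measurable[OF r] by auto
  have "KS_J m k p r f = (\<integral>\<^sup>+ z. ennreal (\<bar>f (fst z) - f (snd z)\<bar> powr p) * k r z \<partial>(m \<Otimes>\<^sub>M m))"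
    unfolding KS_J_def by (subst nn_integral_fst[symmetric]) auto
  also have "\<dots> = (\<integral>\<^sup>+ z. ennreal (\<bar>increment f z\<bar> powr p) \<partial>jump_measure r)"
    unfolding jump_measure_def by (subst nn_integral_density) (auto simp: increment_def mult.commute)
  finally show ?thesis .
qed

lemma KS_J_finite:
  assumes f: "f \<in> borel_measurable m" and r: "0 < r" and fin: "KS_J m k p r f < \<infinity>"
  shows "integrable (jump_measure r) (\<lambda>z. \<bar>increment f z\<bar> powr p)"
    and "enn2real (KS_J m k p r f) = (\<integral>z. \<bar>increment f z\<bar> powr p \<partial>jump_measure r)"
proof -
  have [measurable]: "increment f \<in> borel_measurable (jump_measure r)" using f by (rule increment_measurable)
  show "integrable (jump_measure r) (\<lambda>z. \<bar>increment f z\<bar> powr p)"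
    using fin unfolding KS_J_eq_jump_integral[OF f r] by (intro integrableI_bounded) auto
  show "enn2real (KS_J m k p r f) = (\<integral>z. \<bar>increment f z\<bar> powr p \<partial>jump_measure r)"
    unfolding KS_J_eq_jump_integral[OF f r] by (subst integral_eq_nn_integral) auto
qed

lemma KS_J_mono: "(\<And>x y. \<bar>f x - f y\<bar> \<le> \<bar>g x - g y\<bar>) \<Longrightarrow> KS_J m k p r f \<le> KS_J m k p r g"
  unfolding KS_J_def using p
  by (intro nn_integral_mono mult_right_mono ennreal_leI powr_mono2) auto

lemma KS_J_cong: "(\<And>x y. f x - f y = g x - g y) \<Longrightarrow> KS_J m k p r f = KS_J m k p r g"
  by (simp add: KS_J_def)

lemma KS_sup_mono: "(\<And>x y. \<bar>f x - f y\<bar> \<le> \<bar>g x - g y\<bar>) \<Longrightarrow> KS_sup m k p f \<le> KS_sup m k p g"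
  unfolding KS_sup_def by (intro SUP_mono) (use KS_J_mono in blast)

lemma KS_J_le_sup: "0 < r \<Longrightarrow> KS_J m k p r f \<le> KS_sup m k p f"
  unfolding KS_sup_def by (intro SUP_upper) auto

lemma KS_sup_const: "KS_sup m k p (\<lambda>_. c) = 0"
  by (simp add: KS_sup_def KS_J_def)

lemma KS_J_scale:
  assumes f: "f \<in> borel_measurable m" and r: "0 < r"
  shows "KS_J m k p r (\<lambda>x. a * f x) = ennreal (\<bar>a\<bar> powr p) * KS_J m k p r f"
proof -
  have f': "(\<lambda>x. a * f x) \<in> borel_measurable m" using f by simp
  have [measurable]: "increment f \<in> borel_measurable (jump_measure r)" using f by (rule increment_measurable)
  have "\<bar>increment (\<lambda>x. a * f x) z\<bar> powr p = \<bar>a\<bar> powr p * \<bar>increment f z\<bar> powr p" for z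
    by (simp add: increment_def right_diff_distrib[symmetric] abs_mult powr_mult)
  then show ?thesis
    unfolding KS_J_eq_jump_integral[OF f r] KS_J_eq_jump_integral[OF f' r]
    by (simp add: ennreal_mult nn_integral_cmult)
qed

lemma KS_J_le_sum:
  assumes u: "\<And>i. i < n \<Longrightarrow> u i \<in> borel_measurable m" and g: "g \<in> borel_measurable m" and r: "0 < r" and A: "0 \<le> A"
    and le: "\<And>x y. \<bar>g x - g y\<bar> \<le> A * (\<Sum>i<n. \<bar>u i x - u i y\<bar>)"
  shows "KS_J m k p r g \<le> ennreal (A powr p * real n powr p) * (\<Sum>i<n. KS_J m k p r (u i))"
proof -
  have [measurable]: "i < n \<Longrightarrow> increment (u i) \<in> borel_measurable (jump_measure r)" for i
    using u by (rule increment_measurable)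
  have pt: "\<bar>increment g z\<bar> powr p \<le> (A powr p * real n powr p) * (\<Sum>i<n. \<bar>increment (u i) z\<bar> powr p)" for z
  proof -
    have "\<bar>increment g z\<bar> powr p \<le> (A * (\<Sum>i<n. \<bar>increment (u i) z\<bar>)) powr p"
      using p le[of "fst z" "snd z"] by (intro powr_mono2) (auto simp: increment_def)
    also have "\<dots> = A powr p * (\<Sum>i<n. \<bar>increment (u i) z\<bar>) powr p"
      by (simp add: powr_mult)
    also have "(\<Sum>i<n. \<bar>increment (u i) z\<bar>) powr p \<le> real n powr p * (\<Sum>i<n. \<bar>increment (u i) z\<bar> powr p)"
      using powr_sum_le[of p "{..<n}" "\<lambda>i. \<bar>increment (u i) z\<bar>"] p by simp
    finally show ?thesis by (simp add: mult_left_mono mult.assoc)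
  qed
  have "KS_J m k p r g \<le> (\<integral>\<^sup>+ z. ennreal (A powr p * real n powr p) * (\<Sum>i<n. ennreal (\<bar>increment (u i) z\<bar> powr p)) \<partial>jump_measure r)"
    unfolding KS_J_eq_jump_integral[OF g r]
    using pt by (intro nn_integral_mono) (simp add: ennreal_mult[symmetric] sum_nonneg ennreal_leI)
  also have "\<dots> = ennreal (A powr p * real n powr p) * (\<integral>\<^sup>+ z. (\<Sum>i<n. ennreal (\<bar>increment (u i) z\<bar> powr p)) \<partial>jump_measure r)"
    by (rule nn_integral_cmult) measurable
  also have "(\<integral>\<^sup>+ z. (\<Sum>i<n. ennreal (\<bar>increment (u i) z\<bar> powr p)) \<partial>jump_measure r)
      = (\<Sum>i<n. \<integral>\<^sup>+ z. ennreal (\<bar>increment (u i) z\<bar> powr p) \<partial>jump_measure r)"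
    by (rule nn_integral_sum) simp
  also have "\<dots> = (\<Sum>i<n. KS_J m k p r (u i))"
    using u r by (intro sum.cong) (auto simp: KS_J_eq_jump_integral)
  finally show ?thesis .
qed

text \<open>Lower semicontinuity of the energy under pointwise convergence: the increments converge pointwise,
  and Fatou's lemma applies for the measure on pairs of points.\<close>

lemma KS_J_Fatou:
  assumes "\<And>n. f n \<in> borel_measurable m" and "g \<in> borel_measurable m" and "0 < r"
    and lim: "\<And>x. (\<lambda>n. f n x) \<longlonglongrightarrow> g x"
    and le: "\<And>n. KS_J m k p r (f n) \<le> B"
  shows "KS_J m k p r g \<le> B"
proof -
  have [measurable]: "increment (f n) \<in> borel_measurable (jump_measure r)" for n
    using assms(1) by (rule increment_measurable)
  have lim': "(\<lambda>n. ennreal (\<bar>increment (f n) z\<bar> powr p)) \<longlonglongrightarrow> ennreal (\<bar>increment g z\<bar> powr p)" for z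
    unfolding increment_def using p lim
    by (intro tendsto_ennrealI tendsto_powr2 tendsto_rabs tendsto_diff tendsto_const) auto
  have "KS_J m k p r g = (\<integral>\<^sup>+ z. liminf (\<lambda>n. ennreal (\<bar>increment (f n) z\<bar> powr p)) \<partial>jump_measure r)"
    unfolding KS_J_eq_jump_integral[OF assms(2,3)]
    by (intro nn_integral_cong lim_imp_Liminf[symmetric] lim' trivial_limit_sequentially)
  also have "\<dots> \<le> liminf (\<lambda>n. KS_J m k p r (f n))"
    unfolding KS_J_eq_jump_integral[OF assms(1,3)] by (intro nn_integral_liminf) auto
  also have "\<dots> \<le> B" using le by (intro Liminf_le) auto
  finally show ?thesis .
qed

end

section \<open>Continuous functions of finite energy\<close>

text \<open>The constants are fixed before any sequence of scales, which makes the estimates below uniform over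
  all energy forms of one kernel.\<close>

locale regular_jump_kernel = jump_kernel +
  fixes \<theta> H W :: real
  assumes bounded_UNIV: "bounded (UNIV :: 'a set)"
    and \<theta>: "0 < \<theta>" and H: "0 < H" and W: "0 < W"
    and hoelder: "\<And>f x y. f \<in> KS_cont_space m k p \<Longrightarrow>
      \<bar>f x - f y\<bar> \<le> H * dist x y powr \<theta> * enn2real (KS_sup m k p f) powr (1 / p)"
    and wm: "\<And>f. f \<in> KS_space m k p \<Longrightarrow>
      KS_sup m k p f \<le> ennreal W * Liminf (at_right 0) (\<lambda>r. KS_J m k p r f)"
begin

abbreviation "F \<equiv> KS_cont_space m k p"

lemma F_D:
  assumes "f \<in> F"
  shows "f \<in> KS_space m k p" "continuous_on UNIV f" "f \<in> borel_measurable m" "KS_sup m k p f < \<infinity>"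
  using assms by (auto simp: KS_cont_space_def KS_space_def)

text \<open>A bounded function is \<open>p\<close>-integrable because the measure is finite.\<close>

lemma F_I:
  assumes f: "continuous_on UNIV f" and B: "\<And>x. \<bar>f x\<bar> \<le> B" and fin: "KS_sup m k p f < \<infinity>"
  shows "f \<in> F"
proof -
  have "(\<integral>\<^sup>+ x. ennreal (\<bar>f x\<bar> powr p) \<partial>m) \<le> (\<integral>\<^sup>+ x. ennreal (B powr p) \<partial>m)"
    using B p by (intro nn_integral_mono ennreal_leI powr_mono2) auto
  also have "\<dots> < \<infinity>" using finite_m by (simp add: space_m ennreal_mult_less_top)
  finally show ?thesis using f fin continuous_measurable[OF f] by (simp add: KS_cont_space_def KS_space_def)
qed

lemma F_oscillation:
  "\<exists>L>0. \<forall>f\<in>F. \<forall>x y. \<bar>f x - f y\<bar> \<le> L * enn2real (KS_sup m k p f) powr (1 / p)"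
proof -
  obtain D where D: "\<And>x y :: 'a. dist x y \<le> D" using bounded_UNIV by (auto simp: bounded_two_points)
  show ?thesis
  proof (intro exI conjI ballI allI)
    have "0 \<le> D" using D[of undefined undefined] by simp
    then show "0 < H * (D + 1) powr \<theta>" using H by simp
    fix f and x y :: 'a
    assume f: "f \<in> F"
    have "dist x y powr \<theta> \<le> (D + 1) powr \<theta>" using D[of x y] \<theta> by (intro powr_mono2) auto
    then have "H * dist x y powr \<theta> * enn2real (KS_sup m k p f) powr (1 / p)
        \<le> H * (D + 1) powr \<theta> * enn2real (KS_sup m k p f) powr (1 / p)"
      using H by (intro mult_right_mono mult_left_mono) auto
    then show "\<bar>f x - f y\<bar> \<le> H * (D + 1) powr \<theta> * enn2real (KS_sup m k p f) powr (1 / p)"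
      using hoelder[OF f, of x y] by linarith
  qed
qed

lemma F_bounded:
  assumes "f \<in> F" obtains B where "\<And>x. \<bar>f x\<bar> \<le> B"
proof -
  obtain L where L: "\<bar>f x - f y\<bar> \<le> L * enn2real (KS_sup m k p f) powr (1 / p)" for x y
    using F_oscillation assms by metis
  show ?thesis
  proof
    show "\<bar>f x\<bar> \<le> \<bar>f undefined\<bar> + L * enn2real (KS_sup m k p f) powr (1 / p)" for x
      using L[of x undefined] by linarith
  qed
qed

text \<open>Continuity, boundedness and finite energy are all controlled by increments, so each of them is
  inherited from the functions \<open>u i\<close>. This yields at once that \<open>F\<close> is a linear space containing the
  constants and that it is stable under contractions.\<close>

lemma F_dominated:
  fixes n :: nat and u :: "nat \<Rightarrow> 'a \<Rightarrow> real"
  assumes u: "\<And>i. i < n \<Longrightarrow> u i \<in> F" and A: "0 \<le> A"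
    and le: "\<And>x y. \<bar>g x - g y\<bar> \<le> A * (\<Sum>i<n. \<bar>u i x - u i y\<bar>)"
  shows "g \<in> F"
proof -
  have cont: "continuous_on UNIV g"
    unfolding continuous_on_def
  proof
    fix x :: 'a
    have "(u i \<longlongrightarrow> u i x) (at x)" if "i < n" for i
      using F_D(2)[OF u[OF that]] by (simp add: continuous_on_def)
    then have "((\<lambda>y. A * (\<Sum>i<n. \<bar>u i y - u i x\<bar>)) \<longlongrightarrow> A * (\<Sum>i<n. \<bar>u i x - u i x\<bar>)) (at x)"
      by (intro tendsto_mult tendsto_const tendsto_sum tendsto_rabs tendsto_diff) simp
    then have "((\<lambda>y. A * (\<Sum>i<n. \<bar>u i y - u i x\<bar>)) \<longlongrightarrow> 0) (at x)" by simp
    then have "((\<lambda>y. g y - g x) \<longlongrightarrow> 0) (at x)"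
      by (rule Lim_null_comparison[rotated]) (simp add: le)
    then show "(g \<longlongrightarrow> g x) (at x)" by (simp add: LIM_zero_iff)
  qed
  have "\<forall>i. \<exists>B. i < n \<longrightarrow> (\<forall>x. \<bar>u i x\<bar> \<le> B)"
  proof
    fix i
    show "\<exists>B. i < n \<longrightarrow> (\<forall>x. \<bar>u i x\<bar> \<le> B)"
    proof (cases "i < n")
      case True
      obtain B where "\<And>x. \<bar>u i x\<bar> \<le> B" using F_bounded[OF u[OF True]] by blast
      then show ?thesis by blast
    qed simp
  qed
  from choice[OF this] obtain B where B: "\<And>i x. i < n \<Longrightarrow> \<bar>u i x\<bar> \<le> B i" by blast
  have "\<bar>g x\<bar> \<le> \<bar>g undefined\<bar> + A * (\<Sum>i<n. 2 * B i)" for x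
  proof -
    have "\<bar>u i x - u i undefined\<bar> \<le> 2 * B i" if "i < n" for i
      using B[OF that, of x] B[OF that, of undefined] by linarith
    then have "A * (\<Sum>i<n. \<bar>u i x - u i undefined\<bar>) \<le> A * (\<Sum>i<n. 2 * B i)"
      using A by (intro mult_left_mono sum_mono) auto
    then show ?thesis using le[of x undefined] by linarith
  qed
  moreover have "KS_sup m k p g \<le> ennreal (A powr p * real n powr p) * (\<Sum>i<n. KS_sup m k p (u i))"
    unfolding KS_sup_def[of m k p g]
  proof (rule SUP_least)
    fix r :: real assume "r \<in> {0<..}"
    then have "KS_J m k p r g \<le> ennreal (A powr p * real n powr p) * (\<Sum>i<n. KS_J m k p r (u i))"
      using le A u cont continuous_measurable by (intro KS_J_le_sum) (auto intro: F_D)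
    also have "\<dots> \<le> ennreal (A powr p * real n powr p) * (\<Sum>i<n. KS_sup m k p (u i))"
      using \<open>r \<in> {0<..}\<close> by (intro mult_left_mono sum_mono KS_J_le_sup) auto
    finally show "KS_J m k p r g \<le> ennreal (A powr p * real n powr p) * (\<Sum>i<n. KS_sup m k p (u i))" .
  qed
  moreover have "ennreal (A powr p * real n powr p) * (\<Sum>i<n. KS_sup m k p (u i)) < \<infinity>"
    using F_D(4)[OF u] by (auto simp: ennreal_mult_less_top)
  ultimately show ?thesis using cont by (intro F_I) auto
qed

lemma F_const: "(\<lambda>_. c) \<in> F"
  by (rule F_dominated[of 0 _ 0]) auto

lemma F_add: "u \<in> F \<Longrightarrow> v \<in> F \<Longrightarrow> (\<lambda>x. u x + v x) \<in> F"
  by (rule F_dominated[of 2 "\<lambda>i. if i = 0 then u else v" 1]) (auto simp: numeral_2_eq_2)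

lemma F_scale: "u \<in> F \<Longrightarrow> (\<lambda>x. a * u x) \<in> F"
  by (rule F_dominated[of 1 "\<lambda>_. u" "\<bar>a\<bar>"]) (auto simp: right_diff_distrib[symmetric] abs_mult)

text \<open>Truncation at 0 and 1 does not increase energy and makes the function bounded, hence \<open>p\<close>-integrable,
  which the cutoff function itself need not be.\<close>

lemma F_cutoff:
  assumes cont: "continuous_on UNIV f" and sup: "KS_sup m k p f < B" and f: "1 \<le> f x" "f y = 0"
  obtains g where "g \<in> F" "g x = 1" "g y = 0" "KS_sup m k p g < B"
proof
  let ?g = "\<lambda>z. max 0 (min 1 (f z))"
  have le: "KS_sup m k p ?g \<le> KS_sup m k p f" by (rule KS_sup_mono) auto
  then show "KS_sup m k p ?g < B" using sup by (rule le_less_trans)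
  have "KS_sup m k p ?g < \<infinity>"
    unfolding infinity_ennreal_def using le_less_trans[OF le sup] top_greatest by (rule less_le_trans)
  then show "?g \<in> F" using cont by (intro F_I[of _ 1] continuous_intros) auto
qed (use f in auto)

end

section \<open>Korevaar--Schoen energy forms\<close>

locale korevaar_schoen_form = regular_jump_kernel +
  fixes r :: "nat \<Rightarrow> real"
  assumes seq: "KS_sequence m k p r"
begin

abbreviation "E \<equiv> KS_energy m k p r"

lemma r_pos: "0 < r n" and r_lim: "r \<longlonglongrightarrow> 0"
  using seq by (auto simp: KS_sequence_def)

lemma KS_J_fin:
  assumes "f \<in> F" shows "KS_J m k p (r n) f < \<infinity>"
  using KS_J_le_sup[OF r_pos, of n f] F_D(4)[OF assms] by (rule le_less_trans)

lemma KS_J_tendsto: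
  assumes "f \<in> F" shows "(\<lambda>n. KS_J m k p (r n) f) \<longlonglongrightarrow> ennreal (E f)"
proof -
  obtain l where l: "l < \<infinity>" "(\<lambda>n. KS_J m k p (r n) f) \<longlonglongrightarrow> l"
    using seq F_D(1)[OF assms] unfolding KS_sequence_def by blast
  then have "lim (\<lambda>n. KS_J m k p (r n) f) = l" by (intro limI)
  then show ?thesis using l by (simp add: KS_energy_def)
qed

lemma E_nonneg: "0 \<le> E f"
  by (simp add: KS_energy_def)

lemma KS_J_real_tendsto: "f \<in> F \<Longrightarrow> (\<lambda>n. enn2real (KS_J m k p (r n) f)) \<longlonglongrightarrow> E f"
  by (rule tendsto_enn2real[OF KS_J_tendsto E_nonneg])

lemma E_le_sup: "f \<in> F \<Longrightarrow> ennreal (E f) \<le> KS_sup m k p f"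
  using KS_J_le_sup[OF r_pos] by (intro LIMSEQ_le_const2[OF KS_J_tendsto]) auto

text \<open>The consequence of weak monotonicity that makes all Korevaar--Schoen forms comparable with the
  supremum of the energies, with the same constant: the lower limit as the scale tends to 0 does
  not exceed the limit along a sequence of scales.\<close>

lemma sup_le_E:
  assumes "f \<in> F" shows "KS_sup m k p f \<le> ennreal (W * E f)"
proof -
  have "filterlim r (at_right 0) sequentially"
    using r_lim r_pos by (intro tendsto_imp_filterlim_at_right) auto
  then have "Liminf (at_right 0) (\<lambda>s. KS_J m k p s f) \<le> Liminf (filtermap r sequentially) (\<lambda>s. KS_J m k p s f)"
    unfolding filterlim_def Liminf_def by (intro SUP_subset_mono) (auto simp: le_filter_def)
  also have "\<dots> \<le> liminf (\<lambda>n. KS_J m k p (r n) f)" by (rule Liminf_filtermap_le)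
  also have "\<dots> = ennreal (E f)" using KS_J_tendsto[OF assms] by (intro lim_imp_Liminf) auto
  finally have "ennreal W * Liminf (at_right 0) (\<lambda>s. KS_J m k p s f) \<le> ennreal W * ennreal (E f)"
    by (rule mult_left_mono) simp
  also have "\<dots> = ennreal (W * E f)" using W E_nonneg by (simp add: ennreal_mult)
  finally show ?thesis using wm[OF F_D(1)[OF assms]] by (rule order_trans[rotated])
qed

lemma sup_real_le_E: "f \<in> F \<Longrightarrow> enn2real (KS_sup m k p f) \<le> W * E f"
  using sup_le_E W E_nonneg by (intro enn2real_leI) auto

lemma E_hoelder:
  assumes "f \<in> F"
  shows "\<bar>f x - f y\<bar> powr p \<le> H powr p * W * dist x y powr (\<theta> * p) * E f"
proof -
  have "\<bar>f x - f y\<bar> powr p \<le> (H * dist x y powr \<theta> * enn2real (KS_sup m k p f) powr (1 / p)) powr p"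
    using hoelder[OF assms] p by (intro powr_mono2) auto
  also have "\<dots> = H powr p * dist x y powr (\<theta> * p) * enn2real (KS_sup m k p f)"
    using p H by (simp add: powr_mult powr_powr)
  also have "\<dots> \<le> H powr p * dist x y powr (\<theta> * p) * (W * E f)"
    using sup_real_le_E[OF assms] by (intro mult_left_mono) auto
  finally show ?thesis by (simp add: mult_ac)
qed

lemma E_const: "E (\<lambda>_. c) = 0"
  using E_le_sup[OF F_const, of c] E_nonneg[of "\<lambda>_. c"] by (simp add: KS_sup_const)

lemma E_eq_0_iff: "f \<in> F \<Longrightarrow> E f = 0 \<longleftrightarrow> f \<in> constants"
proof
  assume "f \<in> F" "E f = 0"
  then have "\<bar>f x - f undefined\<bar> powr p \<le> 0" for x using E_hoelder[of f x undefined] by simp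
  then have "f = (\<lambda>_. f undefined)" by (auto simp: fun_eq_iff)
  then show "f \<in> constants" by (metis rangeI)
qed (auto simp: E_const)

lemma E_scale:
  assumes f: "f \<in> F" shows "E (\<lambda>x. a * f x) = \<bar>a\<bar> powr p * E f"
proof -
  have "enn2real (KS_J m k p (r n) (\<lambda>x. a * f x)) = \<bar>a\<bar> powr p * enn2real (KS_J m k p (r n) f)" for n
    using KS_J_scale[OF F_D(3)[OF f] r_pos] by (simp add: enn2real_mult)
  then have "(\<lambda>n. \<bar>a\<bar> powr p * enn2real (KS_J m k p (r n) f)) \<longlonglongrightarrow> E (\<lambda>x. a * f x)"
    using KS_J_real_tendsto[OF F_scale[OF f, of a]] by simp
  moreover have "(\<lambda>n. \<bar>a\<bar> powr p * enn2real (KS_J m k p (r n) f)) \<longlonglongrightarrow> \<bar>a\<bar> powr p * E f"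
    by (intro tendsto_intros KS_J_real_tendsto f)
  ultimately show ?thesis by (rule LIMSEQ_unique)
qed

text \<open>The contraction inequality holds at each scale, as a statement about \<open>L\<^sup>p\<close> norms of increments, and
  the norms involved are continuous in the finitely many energies.\<close>

lemma E_contraction:
  fixes T :: "(nat \<Rightarrow> real) \<Rightarrow> nat \<Rightarrow> real" and q2 :: ereal
  assumes q1: "0 < q1" "q1 \<le> p" and q2: "ereal p \<le> q2" and n2: "1 \<le> n2"
    and T: "\<And>x y. lq_norm q2 n2 (\<lambda>l. T x l - T y l) \<le> lq_norm (ereal q1) n1 (\<lambda>i. x i - y i)"
    and u: "\<And>i. i < n1 \<Longrightarrow> u i \<in> F"
  shows "\<And>l. l < n2 \<Longrightarrow> (\<lambda>x. T (\<lambda>i. u i x) l) \<in> F"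
    and "lq_norm q2 n2 (\<lambda>l. E (\<lambda>x. T (\<lambda>i. u i x) l) powr (1 / p))
           \<le> lq_norm (ereal q1) n1 (\<lambda>i. E (u i) powr (1 / p))"
proof -
  have q2pos: "0 < q2" using p q2 by (cases q2) auto
  define Tu where "Tu l x = T (\<lambda>i. u i x) l" for l x
  have Tu: "lq_norm q2 n2 (\<lambda>l. Tu l x - Tu l y) \<le> lq_norm (ereal q1) n1 (\<lambda>i. u i x - u i y)" for x y
    unfolding Tu_def by (rule T)
  have F: "Tu l \<in> F" if l: "l < n2" for l
  proof (rule F_dominated[where u = u and n = n1 and A = "real n1 powr (1 / q1)"])
    fix x y
    have "\<bar>Tu l x - Tu l y\<bar> \<le> lq_norm q2 n2 (\<lambda>l. Tu l x - Tu l y)"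
      using abs_le_lq_norm[OF q2pos l] .
    also note Tu
    also have "lq_norm (ereal q1) n1 (\<lambda>i. u i x - u i y) \<le> real n1 powr (1 / q1) * (\<Sum>i<n1. \<bar>u i x - u i y\<bar>)"
      using q1(1) by (rule lq_norm_le_sum)
    finally show "\<bar>Tu l x - Tu l y\<bar> \<le> real n1 powr (1 / q1) * (\<Sum>i<n1. \<bar>u i x - u i y\<bar>)" .
  qed (use u in auto)
  then show "\<And>l. l < n2 \<Longrightarrow> (\<lambda>x. T (\<lambda>i. u i x) l) \<in> F" by (simp add: Tu_def[abs_def])
  have pnorm: "enn2real (KS_J m k p (r j) f) = (\<integral>z. \<bar>increment f z\<bar> powr p \<partial>jump_measure (r j))"
      "integrable (jump_measure (r j)) (\<lambda>z. \<bar>increment f z\<bar> powr p)" if "f \<in> F" for f j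
    using KS_J_finite[OF F_D(3)[OF that] r_pos KS_J_fin[OF that]] by auto
  have "lq_norm q2 n2 (\<lambda>l. E (Tu l) powr (1 / p)) \<le> lq_norm (ereal q1) n1 (\<lambda>i. E (u i) powr (1 / p))"
  proof (rule lq_norm_le_limit[OF q1(1) q2pos n2])
    fix j
    have "lq_norm q2 n2 (\<lambda>l. (\<integral>z. \<bar>increment (Tu l) z\<bar> powr p \<partial>jump_measure (r j)) powr (1 / p))
      \<le> lq_norm (ereal q1) n1 (\<lambda>i. (\<integral>z. \<bar>increment (u i) z\<bar> powr p \<partial>jump_measure (r j)) powr (1 / p))"
    proof (rule lq_norm_Lp_contraction[OF p q1 q2 n2])
      show "lq_norm q2 n2 (\<lambda>l. increment (Tu l) z) \<le> lq_norm (ereal q1) n1 (\<lambda>i. increment (u i) z)" for z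
        unfolding increment_def by (rule Tu)
    qed (use F u F_D(3) increment_measurable pnorm(2) in blast)+
    then show "lq_norm q2 n2 (\<lambda>l. enn2real (KS_J m k p (r j) (Tu l)) powr (1 / p))
      \<le> lq_norm (ereal q1) n1 (\<lambda>i. enn2real (KS_J m k p (r j) (u i)) powr (1 / p))"
      using F u by (simp add: pnorm(1) cong: lq_norm_cong)
  qed (use F u p in \<open>auto intro!: tendsto_powr2 KS_J_real_tendsto\<close>)
  then show "lq_norm q2 n2 (\<lambda>l. E (\<lambda>x. T (\<lambda>i. u i x) l) powr (1 / p))
           \<le> lq_norm (ereal q1) n1 (\<lambda>i. E (u i) powr (1 / p))"
    by (simp add: Tu_def[abs_def])
qed

lemma E_generalized_contraction: "generalized_contraction p E F"
  unfolding generalized_contraction_def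
proof (intro allI impI, elim conjE)
  fix n1 n2 :: nat and q1 q2 :: ereal and T :: "(nat \<Rightarrow> real) \<Rightarrow> nat \<Rightarrow> real" and u :: "nat \<Rightarrow> 'a \<Rightarrow> real"
  assume n: "1 \<le> n1" "1 \<le> n2" and q: "0 < q1" "q1 \<le> ereal p" "ereal p \<le> q2"
    and T: "\<forall>x y. lq_norm q2 n2 (\<lambda>l. T x l - T y l) \<le> lq_norm q1 n1 (\<lambda>i. x i - y i)"
    and u: "\<forall>i<n1. u i \<in> F"
  from q obtain q' where q': "q1 = ereal q'" "0 < q'" "q' \<le> p" by (cases q1) auto
  show "(\<forall>l<n2. (\<lambda>x. T (\<lambda>i. u i x) l) \<in> F) \<and>
       lq_norm q2 n2 (\<lambda>l. E (\<lambda>x. T (\<lambda>i. u i x) l) powr (1 / p)) \<le> lq_norm q1 n1 (\<lambda>i. E (u i) powr (1 / p))"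
    using E_contraction[of q' q2 n2 T n1 u] q' q n T u by auto
qed

text \<open>Addition maps \<open>l\<^sup>1\<close> on the plane to the line without increasing norms, and 1 is an admissible
  exponent since \<open>1 \<le> p\<close>.\<close>

lemma E_triangle:
  assumes "u \<in> F" "v \<in> F"
  shows "E (\<lambda>x. u x + v x) powr (1 / p) \<le> E u powr (1 / p) + E v powr (1 / p)"
proof -
  let ?T = "\<lambda>x (l::nat). x 0 + x 1 :: real" and ?u = "\<lambda>i::nat. if i = 0 then u else v"
  have "lq_norm \<infinity> 1 (\<lambda>l. E (\<lambda>x. ?T (\<lambda>i. ?u i x) l) powr (1 / p)) \<le> lq_norm (ereal 1) 2 (\<lambda>i. E (?u i) powr (1 / p))"
    using assms p by (intro E_contraction(2))
      (auto simp: lq_norm_infinity_le_iff lq_norm_ereal numeral_2_eq_2)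
  then show ?thesis by (simp add: lq_norm_infinity_le_iff lq_norm_ereal numeral_2_eq_2)
qed

sublocale seminorm_mod_constants p E F
proof
  show "{u \<in> F. E u = 0} = constants" using E_eq_0_iff F_const by blast
  show "E (\<lambda>x. a * u x) powr (1 / p) = \<bar>a\<bar> * E u powr (1 / p)" if "u \<in> F" for a u
    using p that by (simp add: E_scale powr_mult powr_powr)
qed (use F_const F_add F_scale E_triangle in auto)

text \<open>Subtracting the values at one point makes the sequence uniformly Cauchy, because the energy bounds
  oscillations. For a fixed index the difference to the uniform limit is the pointwise limit of the
  differences to later members, so Fatou's lemma bounds its energy at each scale, and the bound is
  uniform in the scale.\<close>

lemma E_complete:
  assumes u: "\<And>n. u n \<in> F"
    and cauchy: "\<And>e. 0 < e \<Longrightarrow> \<exists>N. \<forall>i\<ge>N. \<forall>j\<ge>N. E (\<lambda>x. u i x - u j x) powr (1 / p) < e"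
  shows "\<exists>v\<in>F. (\<lambda>n. E (\<lambda>x. u n x - v x) powr (1 / p)) \<longlonglongrightarrow> 0"
proof -
  fix x0 :: 'a
  define w where "w n x = u n x - u n x0" for n x
  obtain L where L: "0 < L" and osc: "\<And>f x y. f \<in> F \<Longrightarrow> \<bar>f x - f y\<bar> \<le> L * enn2real (KS_sup m k p f) powr (1 / p)"
    using F_oscillation by blast
  have w: "w n \<in> F" for n unfolding w_def using diff[OF u F_const] .
  have sup_eq: "KS_sup m k p (\<lambda>x. w i x - w j x) = KS_sup m k p (\<lambda>x. u i x - u j x)" for i j
    unfolding KS_sup_def by (intro SUP_cong refl KS_J_cong) (simp add: w_def)
  \<comment> \<open>The factor \<open>W\<close> between the energy and its supremum over all scales is absorbed into the tolerance.\<close>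
  have small: "\<exists>N. \<forall>i\<ge>N. \<forall>j\<ge>N. KS_sup m k p (\<lambda>x. w i x - w j x) \<le> ennreal (e powr p)" if e: "0 < e" for e
  proof -
    have "0 < e / W powr (1 / p)" using e W by simp
    from cauchy[OF this] obtain N where N: "\<forall>i\<ge>N. \<forall>j\<ge>N. E (\<lambda>x. u i x - u j x) powr (1 / p) < e / W powr (1 / p)" ..
    have "KS_sup m k p (\<lambda>x. w i x - w j x) \<le> ennreal (e powr p)" if ij: "N \<le> i" "N \<le> j" for i j
    proof -
      have "(W * E (\<lambda>x. u i x - u j x)) powr (1 / p) \<le> e"
        using N ij W E_nonneg by (fastforce simp: powr_mult field_simps)
      then have "((W * E (\<lambda>x. u i x - u j x)) powr (1 / p)) powr p \<le> e powr p"
        using p by (intro powr_mono2) auto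
      then have "W * E (\<lambda>x. u i x - u j x) \<le> e powr p" using p W E_nonneg by (simp add: powr_powr)
      then show ?thesis using sup_le_E[OF diff[OF u u], of i j] unfolding sup_eq
        by (meson ennreal_leI order_trans)
    qed
    then show ?thesis by blast
  qed
  have unif: "\<exists>N. \<forall>i\<ge>N. \<forall>j\<ge>N. \<forall>x. \<bar>w i x - w j x\<bar> < e" if e: "0 < e" for e
  proof -
    have "0 < e / (2 * L)" using e L by simp
    from small[OF this] obtain N where
      N: "\<forall>i\<ge>N. \<forall>j\<ge>N. KS_sup m k p (\<lambda>x. w i x - w j x) \<le> ennreal ((e / (2 * L)) powr p)" ..
    have "\<bar>w i x - w j x\<bar> < e" if "N \<le> i" "N \<le> j" for i j x
    proof -
      have "enn2real (KS_sup m k p (\<lambda>x. w i x - w j x)) \<le> (e / (2 * L)) powr p"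
        using N that by (intro enn2real_leI) auto
      then have "enn2real (KS_sup m k p (\<lambda>x. w i x - w j x)) powr (1 / p) \<le> ((e / (2 * L)) powr p) powr (1 / p)"
        using p by (intro powr_mono2) auto
      also have "\<dots> = e / (2 * L)" using p e L by (simp add: powr_powr)
      finally have "L * enn2real (KS_sup m k p (\<lambda>x. w i x - w j x)) powr (1 / p) \<le> e / 2"
        using L by (simp add: field_simps)
      then show ?thesis using osc[of "\<lambda>x. w i x - w j x" x x0] diff[OF w w, of i j] e by (simp add: w_def)
    qed
    then show ?thesis by blast
  qed
  then have "uniformly_Cauchy_on UNIV w" unfolding uniformly_Cauchy_on_def dist_real_def by meson
  then obtain v where v: "uniform_limit UNIV w v sequentially"
    using Cauchy_uniformly_convergent by (metis uniformly_convergent_uniform_limit_iff)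
  have cont: "continuous_on UNIV v"
    using F_D(2)[OF w] by (intro uniform_limit_theorem[OF _ v]) auto
  have lim: "(\<lambda>n. w n x) \<longlonglongrightarrow> v x" for x using tendsto_uniform_limitI[OF v] by simp
  have conv: "\<exists>N. \<forall>n\<ge>N. KS_sup m k p (\<lambda>x. w n x - v x) \<le> ennreal (e powr p)" if e: "0 < e" for e
  proof -
    from small[OF e] obtain N where N: "\<forall>i\<ge>N. \<forall>j\<ge>N. KS_sup m k p (\<lambda>x. w i x - w j x) \<le> ennreal (e powr p)" ..
    have "KS_sup m k p (\<lambda>x. w n x - v x) \<le> ennreal (e powr p)" if n: "N \<le> n" for n
      unfolding KS_sup_def
    proof (rule SUP_least)
      fix s :: real assume s: "s \<in> {0<..}"
      show "KS_J m k p s (\<lambda>x. w n x - v x) \<le> ennreal (e powr p)"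
      proof (rule KS_J_Fatou[where f = "\<lambda>j x. w n x - w (j + N) x"])
        show "KS_J m k p s (\<lambda>x. w n x - w (j + N) x) \<le> ennreal (e powr p)" for j
          using N n KS_J_le_sup[of s "\<lambda>x. w n x - w (j + N) x"] s
          by (meson greaterThan_iff le_add2 order_trans)
        show "(\<lambda>j. w n x - w (j + N) x) \<longlonglongrightarrow> w n x - v x" for x
          by (intro tendsto_diff tendsto_const LIMSEQ_ignore_initial_segment lim)
      qed (use s F_D(3)[OF diff[OF w w]] F_D(3)[OF w] continuous_measurable[OF cont] in auto)
    qed
    then show ?thesis by blast
  qed
  \<comment> \<open>Near the end of the sequence the limit is within 1 of a bounded function, so it is bounded.\<close>
  have wv: "(\<lambda>x. w n x - v x) \<in> F" if fin: "KS_sup m k p (\<lambda>x. w n x - v x) < \<infinity>" for n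
  proof -
    obtain N where N: "\<forall>i\<ge>N. \<forall>j\<ge>N. \<forall>x. \<bar>w i x - w j x\<bar> < 1" using unif[of 1] by auto
    obtain B where B: "\<And>x. \<bar>w N x\<bar> \<le> B" using F_bounded[OF w] by blast
    obtain B' where B': "\<And>x. \<bar>w n x\<bar> \<le> B'" using F_bounded[OF w] by blast
    have vB: "\<bar>v x\<bar> \<le> B + 1" for x
    proof (rule LIMSEQ_le_const2[OF tendsto_rabs[OF lim]])
      show "\<exists>N. \<forall>j\<ge>N. \<bar>w j x\<bar> \<le> B + 1"
      proof (intro exI allI impI)
        fix j assume "N \<le> j"
        then have "\<bar>w N x - w j x\<bar> < 1" using N by auto
        then show "\<bar>w j x\<bar> \<le> B + 1" using B[of x] by linarith
      qed
    qed
    have "\<bar>w n x - v x\<bar> \<le> B' + (B + 1)" for x using B'[of x] vB[of x] by linarith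
    then show ?thesis
      using cont F_D(2)[OF w] fin by (intro F_I[of _ "B' + (B + 1)"] continuous_intros) auto
  qed
  obtain n where "KS_sup m k p (\<lambda>x. w n x - v x) \<le> ennreal (1 powr p)" using conv[of 1] by auto
  then have "(\<lambda>x. w n x - v x) \<in> F" by (intro wv) (auto intro: le_less_trans)
  then have vF: "v \<in> F" using diff[OF w[of n]] by fastforce
  have "(\<lambda>n. E (\<lambda>x. u n x - v x) powr (1 / p)) \<longlonglongrightarrow> 0"
  proof (rule LIMSEQ_I)
    fix e :: real assume e: "0 < e"
    then obtain N where N: "\<forall>n\<ge>N. KS_sup m k p (\<lambda>x. w n x - v x) \<le> ennreal ((e / 2) powr p)"
      using conv[of "e / 2"] by auto
    have "E (\<lambda>x. u n x - v x) powr (1 / p) < e" if n: "N \<le> n" for n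
    proof -
      have "KS_sup m k p (\<lambda>x. u n x - v x) = KS_sup m k p (\<lambda>x. w n x - v x)"
        unfolding KS_sup_def by (intro SUP_cong refl KS_J_cong) (simp add: w_def)
      then have "ennreal (E (\<lambda>x. u n x - v x)) \<le> ennreal ((e / 2) powr p)"
        using E_le_sup[OF diff[OF u vF], of n] N n by (metis order_trans)
      then have "E (\<lambda>x. u n x - v x) powr (1 / p) \<le> ((e / 2) powr p) powr (1 / p)"
        using p E_nonneg by (intro powr_mono2) (auto simp: ennreal_le_iff)
      also have "\<dots> = e / 2" using p e by (simp add: powr_powr)
      finally show ?thesis using e by linarith
    qed
    then show "\<exists>N. \<forall>n\<ge>N. norm (E (\<lambda>x. u n x - v x) powr (1 / p) - 0) < e" by auto
  qed
  with vF show ?thesis by blast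
qed

lemma resistance_le:
  "resistance p E F x y \<le> ennreal (H powr p * W * dist x y powr (\<theta> * p))"
  unfolding resistance_def
proof (rule SUP_least, rule ennreal_leI)
  fix u assume u: "u \<in> F - constants"
  then have "0 < E u" using E_eq_0_iff[of u] E_nonneg[of u] by (auto simp: less_le)
  then show "\<bar>u x - u y\<bar> powr p / E u \<le> H powr p * W * dist x y powr (\<theta> * p)"
    using E_hoelder[of u x y] u by (simp add: divide_le_eq)
qed

text \<open>Any function that takes the values 1 at \<open>x\<close> and 0 at \<open>y\<close> competes in the supremum that defines the
  resistance.\<close>

lemma resistance_ge:
  assumes g: "g \<in> F" "g x = 1" "g y = 0" and B: "KS_sup m k p g \<le> ennreal B" "0 < B"
  shows "ennreal (1 / B) \<le> resistance p E F x y"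
proof -
  have nc: "g \<notin> constants" using g(2,3) by auto
  have "0 < E g" using E_eq_0_iff[OF g(1)] nc E_nonneg[of g] by (auto simp: less_le)
  moreover have "E g \<le> B" using E_le_sup[OF g(1)] B by (meson ennreal_le_iff less_imp_le order_trans)
  ultimately have "1 / B \<le> \<bar>g x - g y\<bar> powr p / E g" using B g by (simp add: frac_le)
  then have "ennreal (1 / B) \<le> ennreal (\<bar>g x - g y\<bar> powr p / E g)" by (rule ennreal_leI)
  also have "\<dots> \<le> resistance p E F x y" unfolding resistance_def using g nc by (intro SUP_upper) auto
  finally show ?thesis .
qed

lemma resistance_form_if_separating:
  assumes "\<And>x y. x \<noteq> y \<Longrightarrow> \<exists>u\<in>F. u x \<noteq> u y"
  shows "resistance_form p E F"
  unfolding resistance_form_def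
  using assms E_nonneg constants add scale homogeneous triangle kernel quotient_Metric_space
    quotient_mcomplete[OF E_complete] E_generalized_contraction
    le_less_trans[OF resistance_le ennreal_less_top]
  by simp

end

section \<open>Resistance forms and resistance estimates\<close>

theorem proposition3p13:
  fixes m :: "'a::metric_space measure"
    and k :: "real \<Rightarrow> 'a \<times> 'a \<Rightarrow> ennreal"
    and p Q \<beta> :: real
  assumes p: "1 < p"
    and separable: "separable_space (euclidean :: 'a topology)"
    and two_points: "\<exists>x y :: 'a. x \<noteq> y"
    and borel: "sets m = sets borel"
    and sigma_finite: "sigma_finite_measure m"
    and full_support: "\<And>U. open U \<Longrightarrow> U \<noteq> {} \<Longrightarrow> 0 < emeasure m U"
    and kernel: "\<And>r. 0 < r \<Longrightarrow> k r \<in> borel_measurable borel"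
    and Q: "0 < Q" and \<beta>: "0 < \<beta>" "Q < \<beta>"
    and i: "emeasure m UNIV < \<infinity>" "volume_doubling m Q"
    and ii: "weak_monotonicity m k p"
    and iii: "{u \<in> KS_space m k p. KS_sup m k p u = 0} =
              {u \<in> borel_measurable m. \<exists>c. AE x in m. u x = c}"
    and iv_continuous: "\<forall>f \<in> KS_space m k p. \<exists>g. continuous_on UNIV g \<and> (AE x in m. f x = g x)"
    and iv_hoelder: "\<exists>C>0. \<forall>f \<in> KS_cont_space m k p. \<forall>x y.
              \<bar>f x - f y\<bar> \<le> C * dist x y powr ((\<beta> - Q) / p) * enn2real (KS_sup m k p f) powr (1 / p)"
    and v: "\<exists>C::real. 0 < C \<and> (\<forall>x s. 0 < s \<and> ball x s \<noteq> UNIV \<longrightarrow>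
              (INF f \<in> {f. continuous_on UNIV f \<and> closure {y. f y \<noteq> 0} \<subseteq> ball x (2 * s) \<and>
                           (\<forall>y \<in> ball x s. 1 \<le> f y)}. KS_sup m k p f)
                \<le> ennreal C * (emeasure m (ball x s) / ennreal (s powr \<beta>)))"
  shows "(\<forall>r. KS_sequence m k p r \<longrightarrow>
            resistance_form p (KS_energy m k p r) (KS_cont_space m k p)) \<and>
         (ahlfors_regular m Q \<longrightarrow>
            (\<exists>\<alpha>0 \<alpha>1 :: real. 0 < \<alpha>0 \<and> 0 < \<alpha>1 \<and>
               (\<forall>r. KS_sequence m k p r \<longrightarrow>
                 (\<forall>x y. ennreal (\<alpha>0 * dist x y powr (\<beta> - Q))
                          \<le> resistance p (KS_energy m k p r) (KS_cont_space m k p) x y \<and>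
                        resistance p (KS_energy m k p r) (KS_cont_space m k p) x y
                          \<le> ennreal (\<alpha>1 * dist x y powr (\<beta> - Q))))))"
proof -
  have exponent: "0 < (\<beta> - Q) / p" "(\<beta> - Q) / p * p = \<beta> - Q" using p \<beta> by simp_all
  obtain H where H: "0 < H" "\<And>f x y. f \<in> KS_cont_space m k p \<Longrightarrow>
      \<bar>f x - f y\<bar> \<le> H * dist x y powr ((\<beta> - Q) / p) * enn2real (KS_sup m k p f) powr (1 / p)"
    using iv_hoelder by blast
  obtain W where W: "1 \<le> W" "\<And>f. f \<in> KS_space m k p \<Longrightarrow>
      KS_sup m k p f \<le> ennreal W * Liminf (at_right 0) (\<lambda>r. KS_J m k p r f)"
    using ii unfolding weak_monotonicity_def by blast
  obtain C where C: "0 < C" "\<And>x s. 0 < s \<Longrightarrow> ball x s \<noteq> UNIV \<Longrightarrow>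
      (INF f \<in> {f. continuous_on UNIV f \<and> closure {y. f y \<noteq> 0} \<subseteq> ball x (2 * s) \<and>
          (\<forall>y \<in> ball x s. 1 \<le> f y)}. KS_sup m k p f)
        \<le> ennreal C * (emeasure m (ball x s) / ennreal (s powr \<beta>))"
    using v by blast
  interpret regular_jump_kernel m k p "(\<beta> - Q) / p" H W
  proof
    show "bounded (UNIV :: 'a set)"
      using borel i(1) full_support i(2) by (rule volume_doubling_finite_imp_bounded)
    show "1 \<le> p" "0 < W" using p W(1) by simp_all
  qed (fact separable borel i(1) kernel exponent(1) H W(2))+
  \<comment> \<open>With \<open>s\<close> half the distance, \<open>y\<close> lies just outside the open ball that contains the support of the
    cutoff function.\<close>
  have cutoff: "\<exists>g\<in>F. g x = 1 \<and> g y = 0 \<and> KS_sup m k p g < B"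
    if xy: "x \<noteq> y" and s: "s = dist x y / 2"
      and B: "ennreal C * (emeasure m (ball x s) / ennreal (s powr \<beta>)) < B" for x y s B
  proof -
    have "0 < s" unfolding s using xy by simp
    moreover have "dist x y = 2 * s" unfolding s by simp
    ultimately have "y \<notin> ball x s" "y \<notin> ball x (2 * s)" by auto
    then have "ball x s \<noteq> UNIV" by blast
    from le_less_trans[OF C(2)[OF \<open>0 < s\<close> \<open>ball x s \<noteq> UNIV\<close>] B] obtain f where f: "continuous_on UNIV f"
      "closure {y. f y \<noteq> 0} \<subseteq> ball x (2 * s)" "\<forall>y \<in> ball x s. 1 \<le> f y" "KS_sup m k p f < B"
      unfolding INF_less_iff by blast
    have fx: "1 \<le> f x" using f(3) \<open>0 < s\<close> by simp
    have fy: "f y = 0"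
    proof (rule ccontr)
      assume "f y \<noteq> 0"
      then have "y \<in> closure {y. f y \<noteq> 0}" by (intro subsetD[OF closure_subset]) simp
      then show False using f(2) \<open>y \<notin> ball x (2 * s)\<close> by blast
    qed
    obtain g where "g \<in> F" "g x = 1" "g y = 0" "KS_sup m k p g < B"
      using f(1,4) fx fy by (rule F_cutoff)
    then show ?thesis by blast
  qed
  have form: "resistance_form p (KS_energy m k p r) (KS_cont_space m k p)" if r: "KS_sequence m k p r" for r
  proof -
    interpret korevaar_schoen_form m k p "(\<beta> - Q) / p" H W r by unfold_locales (rule r)
    show ?thesis
    proof (rule resistance_form_if_separating)
      fix x y :: 'a assume xy: "x \<noteq> y"
      have "emeasure m (ball x (dist x y / 2)) \<le> emeasure m UNIV"
        by (rule emeasure_mono) (simp_all add: borel)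
      also have "\<dots> < \<infinity>" by (rule i(1))
      finally have "emeasure m (ball x (dist x y / 2)) / ennreal ((dist x y / 2) powr \<beta>) \<noteq> top"
        using xy by (auto simp: ennreal_divide_eq_top_iff)
      then have "ennreal C * (emeasure m (ball x (dist x y / 2)) / ennreal ((dist x y / 2) powr \<beta>)) < \<infinity>"
        by (simp add: ennreal_mult_less_top less_top)
      from cutoff[OF xy refl this] obtain g where "g \<in> F" "g x = 1" "g y = 0" by blast
      then show "\<exists>u\<in>F. u x \<noteq> u y" by (intro bexI[of _ g]) simp_all
    qed
  qed
  have bounds: "\<exists>\<alpha>0 \<alpha>1 :: real. 0 < \<alpha>0 \<and> 0 < \<alpha>1 \<and>
      (\<forall>r. KS_sequence m k p r \<longrightarrow>
        (\<forall>x y. ennreal (\<alpha>0 * dist x y powr (\<beta> - Q))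
                 \<le> resistance p (KS_energy m k p r) (KS_cont_space m k p) x y \<and>
               resistance p (KS_energy m k p r) (KS_cont_space m k p) x y
                 \<le> ennreal (\<alpha>1 * dist x y powr (\<beta> - Q))))" if ahlfors: "ahlfors_regular m Q"
  proof -
    obtain A where A: "1 \<le> A" "\<And>x s. 0 < s \<Longrightarrow> ereal s < 2 * (SUP (y::'a, z) \<in> UNIV. ereal (dist y z)) \<Longrightarrow>
        emeasure m (ball x s) \<le> ennreal (A * s powr Q)"
      using ahlfors unfolding ahlfors_regular_def by blast
    let ?\<alpha>0 = "1 / (2 * C * A * 2 powr (\<beta> - Q))" and ?\<alpha>1 = "H powr p * W"
    have lower: "ennreal (?\<alpha>0 * dist x y powr (\<beta> - Q)) \<le> resistance p (KS_energy m k p r) F x y"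
      if r: "KS_sequence m k p r" for r x y
    proof (cases "x = y")
      case False
      interpret korevaar_schoen_form m k p "(\<beta> - Q) / p" H W r by unfold_locales (rule r)
      define s where "s = dist x y / 2"
      have s: "0 < s" using False by (simp add: s_def)
      \<comment> \<open>The factor 2 makes the bound on the infimum strict, so that some cutoff function satisfies it.\<close>
      define B where "B = 2 * C * A * s powr (Q - \<beta>)"
      have B: "0 < B" using C A s by (simp add: B_def)
      have "ereal (dist x y) \<le> (SUP (y::'a, z) \<in> UNIV. ereal (dist y z))"
        by (rule SUP_upper2[of "(x, y)"]) auto
      then have "2 * ereal (dist x y) \<le> 2 * (SUP (y::'a, z) \<in> UNIV. ereal (dist y z))"
        by (rule ereal_mult_left_mono) simp
      moreover have "ereal s < 2 * ereal (dist x y)" using False by (simp add: s_def)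
      ultimately have "ereal s < 2 * (SUP (y::'a, z) \<in> UNIV. ereal (dist y z))" by (rule less_le_trans[rotated])
      with s have "emeasure m (ball x s) \<le> ennreal (A * s powr Q)" by (rule A(2))
      then have "ennreal C * (emeasure m (ball x s) / ennreal (s powr \<beta>))
          \<le> ennreal C * (ennreal (A * s powr Q) / ennreal (s powr \<beta>))"
        by (intro mult_left_mono divide_right_mono_ennreal) auto
      also have "\<dots> = ennreal (C * (A * s powr Q / s powr \<beta>))"
        using C(1) A(1) s by (simp add: divide_ennreal ennreal_mult[symmetric])
      also have "C * (A * s powr Q / s powr \<beta>) = B / 2" by (simp add: B_def powr_diff)
      also have "ennreal (B / 2) < ennreal B" using B by (intro ennreal_lessI) auto
      finally obtain g where g: "g \<in> F" "g x = 1" "g y = 0" "KS_sup m k p g < ennreal B"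
        using cutoff[OF False s_def] by blast
      have "?\<alpha>0 * dist x y powr (\<beta> - Q) = 1 / B"
        using s by (simp add: B_def s_def powr_divide powr_diff field_simps)
      then show ?thesis using resistance_ge[OF g(1-3) less_imp_le[OF g(4)] B] by simp
    qed simp
    have upper: "resistance p (KS_energy m k p r) F x y \<le> ennreal (?\<alpha>1 * dist x y powr (\<beta> - Q))"
      if r: "KS_sequence m k p r" for r x y
    proof -
      interpret korevaar_schoen_form m k p "(\<beta> - Q) / p" H W r by unfold_locales (rule r)
      show ?thesis using resistance_le[of x y] exponent(2) by simp
    qed
    have "0 < ?\<alpha>0" "0 < ?\<alpha>1" using C(1) A(1) H(1) W(1) by auto
    with lower upper show ?thesis by blast
  qed
  show ?thesis using form bounds by blast
qed

end
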